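(* For every pair of integers $l>k\ge 1$ there exists a constant $\varepsilon=\varepsilon(k,l)>0$ such that $$\operatorname{ex}\!\left(n,C_{2k+1},\mathscr{C}_{2k}\cup\{C_{2l+1}\}\right)=O_{k,l}\!\left(n^{2-\varepsilon}\right).$$
   Context: All graphs are finite and simple. $C_i$ denotes the cycle of length $i$ ($i\ge 3$), $\mathscr{C}_r=\{C_3,C_4,\ldots,C_r\}$ for $r\ge 3$, and $\mathscr{C}_2=\varnothing$. For a family $\mathcal F$ of graphs, a graph is $\mathcal F$-free if it contains no member of $\mathcal F$ as a (not necessarily induced) subgraph. For graphs $H$ and $G$, $N(H,G)$ is the number of copies of $H$ in $G$, counted as unlabeled, not necessarily induced subgraphs. The generalized Turán number is $\operatorname{ex}(n,H,\mathcal F)=\max\{N(H,G): |V(G)|=n \text{ and } G \text{ is } \mathcal F\text{-free}\}$. The notation $O_{k,l}(\cdot)$ means that the implied constant depends only on $k$ and $l$ (the bound holding for all $n\ge 1$). *)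

theory Defs
  imports Complex_Main
begin

type_synonym 'a graph = "'a set \<times> 'a set set"

abbreviation verts :: "'a graph \<Rightarrow> 'a set" where
  "verts G \<equiv> fst G"

abbreviation edges :: "'a graph \<Rightarrow> 'a set set" where
  "edges G \<equiv> snd G"

definition simple_graph :: "'a graph \<Rightarrow> bool" where
  "simple_graph G \<longleftrightarrow> finite (verts G) \<and> (\<forall>e \<in> edges G. e \<subseteq> verts G \<and> card e = 2)"

definition subgraph :: "'a graph \<Rightarrow> 'a graph \<Rightarrow> bool" where
  "subgraph S G \<longleftrightarrow> simple_graph S \<and> verts S \<subseteq> verts G \<and> edges S \<subseteq> edges G"

definition graph_iso :: "'a graph \<Rightarrow> 'b graph \<Rightarrow> bool" where
  "graph_iso G H \<longleftrightarrow>
     (\<exists>f. bij_betw f (verts G) (verts H) \<and> edges H = (\<lambda>e. f ` e) ` edges G)"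

definition copies :: "'b graph \<Rightarrow> 'a graph \<Rightarrow> 'a graph set" where
  "copies H G = {S. subgraph S G \<and> graph_iso S H}"

definition num_copies :: "'b graph \<Rightarrow> 'a graph \<Rightarrow> nat" where
  "num_copies H G = card (copies H G)"

definition free_of :: "'b graph set \<Rightarrow> 'a graph \<Rightarrow> bool" where
  "free_of F G \<longleftrightarrow> (\<forall>H \<in> F. copies H G = {})"

text \<open>Host graphs have vertices in \<open>nat\<close>; every finite graph is isomorphic to such a graph.
  The maximum is over a finite set (lemma \<open>finite_gen_turan_values\<close>), which is nonempty as soon
  as every member of \<open>F\<close> has an edge (lemma \<open>gen_turan_values_nonempty\<close>).\<close>

definition gen_turan_values :: "nat \<Rightarrow> 'b graph \<Rightarrow> 'b graph set \<Rightarrow> nat set" where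
  "gen_turan_values n H F =
     {num_copies H G | G :: nat graph. simple_graph G \<and> card (verts G) = n \<and> free_of F G}"

definition gen_turan :: "nat \<Rightarrow> 'b graph \<Rightarrow> 'b graph set \<Rightarrow> nat" where
  "gen_turan n H F = Max (gen_turan_values n H F)"

text \<open>Only meaningful as a cycle for \<open>i \<ge> 3\<close>.\<close>

definition cycle_graph :: "nat \<Rightarrow> nat graph" where
  "cycle_graph i = ({..<i}, {{j, Suc j mod i} | j. j < i})"

definition cycles_upto :: "nat \<Rightarrow> nat graph set" where
  "cycles_upto r = cycle_graph ` {3..r}"

lemma simple_graph_cycle_graph:
  assumes "i \<ge> 3"
  shows "simple_graph (cycle_graph i)"
proof -
  have "j \<noteq> Suc j mod i" if "j < i" for j
    using that assms by (cases "Suc j = i") auto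
  then show ?thesis
    using assms by (auto simp: simple_graph_def cycle_graph_def card_2_iff)
qed

lemma finite_gen_turan_values: "finite (gen_turan_values n H F)"
proof (rule finite_subset)
  show "gen_turan_values n H F \<subseteq> {..2 ^ n * 2 ^ 2 ^ n}"
  proof
    fix m assume "m \<in> gen_turan_values n H F"
    then obtain G :: "nat graph" where G: "simple_graph G" "card (verts G) = n" "m = num_copies H G"
      by (auto simp: gen_turan_values_def)
    have fin: "finite (verts G)"
      using G by (simp add: simple_graph_def)
    have sub: "copies H G \<subseteq> Pow (verts G) \<times> Pow (Pow (verts G))"
      using G(1) by (fastforce simp: copies_def subgraph_def simple_graph_def)
    have "m \<le> card (Pow (verts G) \<times> Pow (Pow (verts G)))"
      unfolding G(3) num_copies_def by (rule card_mono[OF _ sub]) (simp add: fin)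
    also have "\<dots> = 2 ^ n * 2 ^ 2 ^ n"
      using fin G(2) by (simp add: card_cartesian_product card_Pow)
    finally show "m \<in> {..2 ^ n * 2 ^ 2 ^ n}" by simp
  qed
qed simp

lemma gen_turan_values_nonempty:
  assumes "\<forall>H' \<in> F. edges H' \<noteq> {}"
  shows "gen_turan_values n H F \<noteq> {}"
proof -
  let ?G = "({..<n}, {}) :: nat graph"
  have "free_of F ?G"
    using assms by (auto simp: free_of_def copies_def subgraph_def graph_iso_def)
  moreover have "simple_graph ?G" "card (verts ?G) = n"
    by (auto simp: simple_graph_def)
  ultimately show ?thesis
    unfolding gen_turan_values_def by blast
qed

end

theory Submission
  imports Defs "HOL-Analysis.Convex" "HOL-Library.FuncSet"
begin

text \<open>
  Write \<open>s = l - k\<close> and let \<open>G\<close> have \<open>n\<close> vertices, no cycle of length at most \<open>2k\<close> and none of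
  length \<open>2l + 1 = 2k + 1 + 2s\<close>. Colour the vertices with \<open>0, \<dots>, 2k\<close> so that a positive fraction,
  depending on \<open>k\<close> only, of the cycles of length \<open>2k + 1\<close> is coloured \<open>0, 1, \<dots>, 2k\<close> in cyclic order
  (\<open>good_colouring\<close>). In a coloured cycle \<open>x\<^sub>0 \<dots> x\<^sub>2\<^sub>k\<close> the vertices \<open>x\<^sub>0, x\<^sub>k, x\<^sub>k\<^sub>+\<^sub>1\<close> determine the
  rest, by the girth condition. The colours are there to make arcs taken from different cycles
  disjoint, so that a forbidden cycle can be glued together from arcs and one long path, which any
  sufficiently dense bipartite graph contains (\<open>bipartite_path\<close>).

  The first gluing fixes \<open>v = x\<^sub>0\<close> and takes the graph of the edges \<open>x\<^sub>k x\<^sub>k\<^sub>+\<^sub>1\<close> of coloured cycles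
  through \<open>v\<close>. A path with \<open>2s + 1\<close> edges in it, closed up through \<open>v\<close>, is a cycle of length \<open>2l + 1\<close>.
  So this graph has a number of edges linear in its number of non-isolated vertices
  (\<open>coloured_cycles_through_le\<close>), and a vertex lies on \<open>O(n)\<close> cycles of length \<open>2k + 1\<close>. This gives
  the trivial bound \<open>O(n\<^sup>2)\<close>, and it allows any \<open>n\<^bsup>1-\<epsilon>\<^esup>\<close> vertices to be discarded. It also shows that
  it is enough to bound by \<open>O(n\<^bsup>2-\<epsilon>\<^esup>)\<close> the number of pairs \<open>(x\<^sub>0, x\<^sub>k)\<close> occurring in the cycles
  left, since the pairs \<open>(x\<^sub>0, x\<^sub>k\<^sub>+\<^sub>1)\<close> are the same thing for the reflected colouring.

  The vertices to discard are the heavy ones: those of a colour \<open>j\<close> strictly between \<open>0\<close> and \<open>k\<close> from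
  which more than about \<open>n\<^bsup>1-1/3^j\<^esup>\<close> vertices of colour \<open>0\<close> can be reached by paths that go down
  through all colours and avoid the heavy vertices of smaller colours. They are few
  (\<open>card_heavy_le\<close>), because of girth: a heavy vertex has many light neighbours of colour \<open>j - 1\<close>,
  whereas a light vertex \<open>y\<close> has few heavy neighbours, as these reach through paths avoiding \<open>y\<close>
  large and pairwise disjoint sets.

  The second gluing (\<open>light_edges_le\<close>) fixes \<open>v\<close> of colour \<open>0\<close>, lets \<open>\<Gamma>(v)\<close> be the set of the \<open>x\<^sub>k\<close>
  that are paired with \<open>v\<close>, and takes the bipartite graph between \<open>\<Gamma>(v)\<close> and those light vertices of
  colour \<open>k - 1\<close> that do not reach \<open>v\<close>. A path with \<open>2s\<close> edges between two vertices of \<open>\<Gamma>(v)\<close> in it is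
  closed up by a path of length \<open>k\<close> to \<open>v\<close> from one end and a path of length \<open>k + 1\<close> to \<open>v\<close> from the other,
  again to a cycle of length \<open>2l + 1\<close>. So this graph has \<open>O(n)\<close> edges. On the other hand, a vertex
  \<open>w\<close> paired with \<open>g(w)\<close> vertices has at least \<open>g(w) / n\<^bsup>1-\<delta>\<^esup>\<close> light neighbours of colour \<open>k - 1\<close>, up
  to a constant and for some \<open>\<delta> > 0\<close>, at most one of which reaches a given \<open>v\<close>. Summing over \<open>v\<close> gives
  \<open>\<Sum>\<^sub>w g(w)\<^sup>2 = O(n\<^bsup>3-\<delta>\<^esup>)\<close>, and the Cauchy-Schwarz inequality turns this into
  \<open>\<Sum>\<^sub>w g(w) = O(n\<^bsup>2-\<delta>/2\<^esup>)\<close> (\<open>card_opposite_pairs_le\<close>).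
\<close>

section \<open>Long paths in dense graphs\<close>

text \<open>Deleting a vertex with at most \<open>d\<close> neighbours destroys at most \<open>2 * d\<close> ordered pairs, so the
  density hypothesis survives until no such vertex is left.\<close>

lemma dense_core:
  assumes "finite W" "symp R" "2 * d * card W < card {(x, y) \<in> W \<times> W. R x y}"
  shows "\<exists>U \<subseteq> W. U \<noteq> {} \<and> (\<forall>u \<in> U. d < card {y \<in> U. R u y})"
  using assms(1,3)
proof (induction "card W" arbitrary: W rule: less_induct)
  case less
  show ?case
  proof (cases "\<forall>u \<in> W. d < card {y \<in> W. R u y}")
    case True
    moreover have "W \<noteq> {}" using less.prems by auto
    ultimately show ?thesis by blast
  next
    case False
    then obtain u where u: "u \<in> W" "card {y \<in> W. R u y} \<le> d" by force
    let ?N = "{y \<in> W. R u y}" and ?W' = "W - {u}"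
    let ?P = "\<lambda>W. {(x, y) \<in> W \<times> W. R x y}"
    have fin: "finite ?N" "finite (?P ?W')"
      using less.prems(1) by (auto intro: finite_subset[of _ "W \<times> W"])
    have "?P W \<subseteq> ?P ?W' \<union> ({u} \<times> ?N \<union> ?N \<times> {u})"
      using u(1) \<open>symp R\<close> by (auto dest: sympD)
    then have "card (?P W) \<le> card (?P ?W' \<union> ({u} \<times> ?N \<union> ?N \<times> {u}))"
      using fin by (intro card_mono) auto
    also have "\<dots> \<le> card (?P ?W') + card ({u} \<times> ?N \<union> ?N \<times> {u})"
      by (rule card_Un_le)
    also have "\<dots> \<le> card (?P ?W') + (card ({u} \<times> ?N) + card (?N \<times> {u}))"
      by (intro add_left_mono card_Un_le)
    also have "\<dots> = card (?P ?W') + 2 * card ?N"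
      by (simp add: card_cartesian_product)
    finally have "card (?P W) \<le> card (?P ?W') + 2 * d" using u(2) by linarith
    moreover have cW: "card W = Suc (card ?W')"
      using u(1) less.prems(1) by (metis card_Suc_Diff1)
    then have "2 * d * card W = 2 * d * card ?W' + 2 * d" by simp
    ultimately have "2 * d * card ?W' < card (?P ?W')"
      using less.prems(2) by linarith
    moreover have "card ?W' < card W" "finite ?W'" using cW less.prems(1) by auto
    ultimately obtain U where "U \<subseteq> ?W'" "U \<noteq> {}" "\<forall>u \<in> U. d < card {y \<in> U. R u y}"
      using less.hyps[of ?W'] by blast
    then show ?thesis by blast
  qed
qed

lemma greedy_path:
  assumes "finite U" "symp R" "\<forall>u \<in> U. d < card {y \<in> U. R u y}" "u \<in> U" "m \<le> d"
  shows "\<exists>xs. length xs = Suc m \<and> distinct xs \<and> set xs \<subseteq> U \<and> successively R xs \<and> hd xs = u"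
  using assms(4,5)
proof (induction m arbitrary: u)
  case 0
  then show ?case by (intro exI[of _ "[u]"]) auto
next
  case (Suc m)
  then obtain xs where xs: "length xs = Suc m" "distinct xs" "set xs \<subseteq> U" "successively R xs"
    "hd xs = u" by (metis Suc_leD)
  let ?x = "last xs"
  have x: "?x \<in> U" using xs by (metis last_in_set list.size(3) nat.distinct(1) subsetD)
  have "card (set xs) \<le> d" using xs(1,2) Suc.prems(2) by (simp add: distinct_card)
  then have "card (set xs) < card {y \<in> U. R ?x y}" using assms(3) x by fastforce
  then have "\<not> {y \<in> U. R ?x y} \<subseteq> set xs"
    by (meson card_mono finite_set linorder_not_less)
  then obtain y where y: "y \<in> U" "R ?x y" "y \<notin> set xs" by blast
  have "successively R (xs @ [y])" using xs y by (auto simp: successively_append_iff)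
  moreover have "hd (xs @ [y]) = u" using xs by (cases xs) auto
  ultimately show ?case
    using xs y by (intro exI[of _ "xs @ [y]"]) auto
qed

text \<open>The path starts in \<open>A\<close>, so the parity of \<open>d\<close> decides on which side it ends; this is what
  fixes the lengths of the cycles built from it.\<close>

lemma bipartite_path:
  assumes fin: "finite A" "finite B" and disj: "A \<inter> B = {}" and F: "F \<subseteq> A \<times> B"
    and dense: "d * (card A + card B) < card F"
  obtains xs where "length xs = Suc d" "distinct xs"
    "successively (\<lambda>x y. (x, y) \<in> F \<or> (y, x) \<in> F) xs"
    "\<And>i. i \<le> d \<Longrightarrow> xs ! i \<in> (if even i then A else B)"
proof -
  define R where "R = (\<lambda>x y. (x, y) \<in> F \<or> (y, x) \<in> F)"
  have sym: "symp R" by (auto simp: R_def symp_def)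
  have finF: "finite F" using F fin by (meson finite_SigmaI finite_subset)
  have pairs: "{(x, y) \<in> (A \<union> B) \<times> (A \<union> B). R x y} = F \<union> F\<inverse>"
    using F by (auto simp: R_def)
  have "card (F \<union> F\<inverse>) = card F + card (F\<inverse>)"
    using F disj finF by (intro card_Un_disjoint) auto
  also have "\<dots> = 2 * card F" by (simp add: card_inverse)
  finally have "2 * d * card (A \<union> B) < card {(x, y) \<in> (A \<union> B) \<times> (A \<union> B). R x y}"
    using dense fin disj unfolding pairs by (simp add: card_Un_disjoint)
  then obtain U where U: "U \<subseteq> A \<union> B" "U \<noteq> {}" "\<forall>u \<in> U. d < card {y \<in> U. R u y}"
    using dense_core[of "A \<union> B" R d] sym fin by auto
  have "\<exists>u \<in> U. u \<in> A"
  proof -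
    from U(2) obtain u where u: "u \<in> U" by blast
    then have "0 < card {y \<in> U. R u y}" using U(3) by fastforce
    then have "{y \<in> U. R u y} \<noteq> {}" by (metis card.empty less_irrefl)
    then obtain y where "y \<in> U" "R u y" by blast
    then show ?thesis using u F by (auto simp: R_def)
  qed
  then obtain u where u: "u \<in> U" "u \<in> A" by blast
  have "finite U" using U(1) fin by (meson finite_Un finite_subset)
  from greedy_path[OF this sym U(3) u(1) order_refl]
  obtain xs where xs: "length xs = Suc d" "distinct xs" "set xs \<subseteq> U" "successively R xs" "hd xs = u"
    by blast
  have alt: "xs ! i \<in> (if even i then A else B)" if "i \<le> d" for i
    using that
  proof (induction i)
    case 0
    then show ?case using xs(1,5) u(2) by (cases xs) auto
  next
    case (Suc i)
    have "R (xs ! i) (xs ! Suc i)"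
      using successively_nth[OF xs(4), of i] xs(1) Suc.prems by simp
    then show ?case using Suc F disj by (auto simp: R_def split: if_splits)
  qed
  show ?thesis using that xs alt unfolding R_def by blast
qed

section \<open>Cycles as lists of vertices\<close>

definition cycle_list :: "('a \<Rightarrow> 'a \<Rightarrow> bool) \<Rightarrow> 'a list \<Rightarrow> bool" where
  "cycle_list adj xs \<longleftrightarrow> 3 \<le> length xs \<and> distinct xs \<and> successively adj xs \<and> adj (last xs) (hd xs)"

lemma cycle_list_nth_mod:
  assumes "cycle_list adj xs" "i < length xs"
  shows "adj (xs ! i) (xs ! (Suc i mod length xs))"
proof (cases "Suc i = length xs")
  case True
  then show ?thesis
    using assms by (auto simp: cycle_list_def last_conv_nth hd_conv_nth)
      (metis One_nat_def diff_Suc_1 hd_conv_nth last_conv_nth length_0_conv nat.distinct(1))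
next
  case False
  then show ?thesis using assms by (auto simp: cycle_list_def successively_conv_nth)
qed

lemma cycle_listI_nth_mod:
  assumes "3 \<le> length xs" "distinct xs"
    and adj: "\<And>i. i < length xs \<Longrightarrow> adj (xs ! i) (xs ! (Suc i mod length xs))"
  shows "cycle_list adj xs"
proof -
  have "adj (xs ! i) (xs ! Suc i)" if "Suc i < length xs" for i
    using adj[of i] that by simp
  moreover have "xs \<noteq> []" using assms(1) by auto
  moreover have "adj (last xs) (hd xs)"
    using adj[of "length xs - 1"] \<open>xs \<noteq> []\<close> by (simp add: last_conv_nth hd_conv_nth)
  ultimately show ?thesis using assms by (auto simp: cycle_list_def successively_conv_nth)
qed

lemma cycle_list_rotate:
  assumes "cycle_list adj xs"
  shows "cycle_list adj (rotate j xs)"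
proof (rule cycle_listI_nth_mod)
  show "3 \<le> length (rotate j xs)" "distinct (rotate j xs)"
    using assms by (auto simp: cycle_list_def)
  fix i assume i: "i < length (rotate j xs)"
  let ?m = "length xs"
  have m: "0 < ?m" using i by auto
  have "Suc i mod ?m < ?m" using m by simp
  then have "rotate j xs ! (Suc i mod ?m) = xs ! ((j + Suc i mod ?m) mod ?m)"
    by (rule nth_rotate)
  also have "(j + Suc i mod ?m) mod ?m = Suc ((j + i) mod ?m) mod ?m"
    by (simp add: mod_simps)
  finally show "adj (rotate j xs ! i) (rotate j xs ! (Suc i mod length (rotate j xs)))"
    using i m cycle_list_nth_mod[OF assms, of "(j + i) mod ?m"] by (simp add: nth_rotate)
qed

section \<open>Random colourings\<close>

text \<open>A uniformly random map \<open>V \<rightarrow> {..<m}\<close> gives the \<open>i\<close>-th entry of a fixed list the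
  colour \<open>i\<close>, for all \<open>i\<close> at once, with probability \<open>1 / m ^ m\<close>; some colouring does at least as
  well as the average.\<close>

lemma good_colouring:
  assumes V: "finite V" and S: "finite S"
    and lists: "\<And>xs. xs \<in> S \<Longrightarrow> length xs = m \<and> distinct xs \<and> set xs \<subseteq> V"
    and m: "0 < m"
  shows "\<exists>\<phi>. card S \<le> m ^ m * card {xs \<in> S. \<forall>i<m. \<phi> (xs ! i) = i}"
proof (rule ccontr)
  assume contra: "\<nexists>\<phi>. card S \<le> m ^ m * card {xs \<in> S. \<forall>i<m. \<phi> (xs ! i) = i}"
  define \<Phi> where "\<Phi> = (V \<rightarrow>\<^sub>E {..<m})"
  let ?good = "\<lambda>\<phi> xs. \<forall>i<m. \<phi> (xs ! i) = i"
  have card\<Phi>: "card \<Phi> = m ^ card V" unfolding \<Phi>_def using V by (simp add: card_funcsetE)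
  have fin\<Phi>: "finite \<Phi>" unfolding \<Phi>_def using V by (intro finite_PiE) auto
  have count: "m ^ m * card {\<phi> \<in> \<Phi>. ?good \<phi> xs} = m ^ card V" if xs: "xs \<in> S" for xs
  proof -
    have L: "length xs = m" "distinct xs" "set xs \<subseteq> V" using lists[OF xs] by auto
    define pos where "pos = inv_into {..<m} ((!) xs)"
    have inj: "inj_on ((!) xs) {..<m}" using L by (auto simp: inj_on_def nth_eq_iff_index_eq)
    have pos: "pos (xs ! i) = i" if "i < m" for i
      unfolding pos_def using inj that by (simp add: inv_into_f_f)
    have "{\<phi> \<in> \<Phi>. ?good \<phi> xs} = (\<Pi>\<^sub>E x\<in>V. if x \<in> set xs then {pos x} else {..<m})"
    proof (rule set_eqI)
      fix \<phi>
      have "(\<forall>i<m. \<phi> (xs ! i) = i) \<longleftrightarrow> (\<forall>x \<in> set xs. \<phi> x = pos x)"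
        using L(1) pos by (auto simp: all_set_conv_all_nth)
      moreover have "pos x < m" if "x \<in> set xs" for x
        using that L(1) pos by (auto simp: in_set_conv_nth)
      ultimately show "\<phi> \<in> {\<phi> \<in> \<Phi>. ?good \<phi> xs} \<longleftrightarrow>
          \<phi> \<in> (\<Pi>\<^sub>E x\<in>V. if x \<in> set xs then {pos x} else {..<m})"
        unfolding \<Phi>_def PiE_iff using L(3) by (auto split: if_splits)
    qed
    then have "card {\<phi> \<in> \<Phi>. ?good \<phi> xs}
        = (\<Prod>x\<in>V. card (if x \<in> set xs then {pos x} else {..<m}))"
      using V by (simp add: card_PiE)
    also have "\<dots> = (\<Prod>x\<in>V. if x \<in> set xs then 1 else m)"
      by (intro prod.cong) auto
    also have "\<dots> = (\<Prod>x\<in>V - set xs. m)"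
      using V by (intro prod.mono_neutral_cong_right) auto
    also have "\<dots> = m ^ (card V - m)"
      using L by (simp add: card_Diff_subset distinct_card)
    finally have "m ^ m * card {\<phi> \<in> \<Phi>. ?good \<phi> xs} = m ^ (m + (card V - m))"
      by (simp add: power_add)
    moreover have "m \<le> card V" using L V by (metis card_mono distinct_card)
    ultimately show ?thesis by simp
  qed
  have "m ^ m * (\<Sum>\<phi>\<in>\<Phi>. card {xs \<in> S. ?good \<phi> xs})
      = m ^ m * (\<Sum>xs\<in>S. card {\<phi> \<in> \<Phi>. ?good \<phi> xs})"
    using sum_multicount_gen[OF fin\<Phi> S, of ?good] by simp
  also have "\<dots> = (\<Sum>xs\<in>S. m ^ m * card {\<phi> \<in> \<Phi>. ?good \<phi> xs})"
    by (rule sum_distrib_left)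
  also have "\<dots> = card S * card \<Phi>" using count by (simp add: card\<Phi>)
  finally have eq: "(\<Sum>\<phi>\<in>\<Phi>. m ^ m * card {xs \<in> S. ?good \<phi> xs}) = card \<Phi> * card S"
    by (simp add: sum_distrib_left)
  have "\<Phi> \<noteq> {}" using card\<Phi> m by (metis card.empty power_not_zero less_not_refl)
  then have "(\<Sum>\<phi>\<in>\<Phi>. m ^ m * card {xs \<in> S. ?good \<phi> xs}) < (\<Sum>\<phi>\<in>\<Phi>. card S)"
    using contra fin\<Phi> by (intro sum_strict_mono) (auto simp: not_le)
  then show False using eq by simp
qed

section \<open>The cycles of length 2k+1 through a vertex\<close>

locale odd_cycle_host =
  fixes V :: "'a set" and adj :: "'a \<Rightarrow> 'a \<Rightarrow> bool" and k s :: nat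
  assumes fin: "finite V" and nonempty: "V \<noteq> {}"
    and adj_sym: "adj x y \<Longrightarrow> adj y x"
    and adj_V: "adj x y \<Longrightarrow> x \<in> V \<and> y \<in> V"
    and k: "1 \<le> k"
    and no_short: "cycle_list adj xs \<Longrightarrow> 2 * k < length xs"
    and no_long: "cycle_list adj xs \<Longrightarrow> length xs \<noteq> 2 * k + 2 * s + 1"
begin

abbreviation n :: nat where "n \<equiv> card V"

lemma n_pos: "0 < n"
  using fin nonempty by (simp add: card_gt_0_iff)

text \<open>Two different walks can only separate and meet again at equal times, so the arcs between two
  consecutive meetings form a cycle, of even length at most \<open>2 * m\<close>. All uses of the girth condition
  go through this lemma; its hypotheses hold because colours tell the positions on the walks.\<close>

lemma sync_walks_eq:
  fixes p q :: "nat \<Rightarrow> 'a"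
  assumes m: "m \<le> k"
    and p: "\<And>i. i < m \<Longrightarrow> adj (p i) (p (Suc i))" and q: "\<And>i. i < m \<Longrightarrow> adj (q i) (q (Suc i))"
    and p_inj: "inj_on p {..m}" and q_inj: "inj_on q {..m}"
    and sync: "\<And>i j. i \<le> m \<Longrightarrow> j \<le> m \<Longrightarrow> p i = q j \<Longrightarrow> i = j"
    and ends: "p 0 = q 0" "p m = q m" and h: "h \<le> m"
  shows "p h = q h"
proof (rule ccontr)
  assume neq: "p h \<noteq> q h"
  \<comment> \<open>the last meeting before time \<open>h\<close> and the first one after it\<close>
  define a where "a = Max {i. i \<le> h \<and> p i = q i}"
  define b where "b = (LEAST i. h \<le> i \<and> p i = q i)"
  have "finite {i. i \<le> h \<and> p i = q i}" "{i. i \<le> h \<and> p i = q i} \<noteq> {}"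
    using ends(1) by auto
  then have a: "a \<le> h" "p a = q a" and a_max: "\<And>i. i \<le> h \<Longrightarrow> p i = q i \<Longrightarrow> i \<le> a"
    using Max_in[of "{i. i \<le> h \<and> p i = q i}"] unfolding a_def by auto
  have b: "h \<le> b" "p b = q b" and b_min: "\<And>i. h \<le> i \<Longrightarrow> p i = q i \<Longrightarrow> b \<le> i"
    unfolding b_def using LeastI[of "\<lambda>i. h \<le> i \<and> p i = q i" m] ends(2) h
    by (auto intro: Least_le)
  have bm: "b \<le> m" using b_min ends(2) h by blast
  have "a \<noteq> h" "b \<noteq> h" using a b neq by auto
  then have ab: "a < h" "h < b" using a b by auto
  let ?xs = "map p [a..<b] @ map q (rev [Suc a..<Suc b])"
  have up: "successively (\<lambda>i j. j = Suc i) [i..<j]" for i j :: nat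
    by (simp add: successively_conv_nth)
  have sp: "successively adj (map p [a..<b])"
    unfolding successively_map by (rule successively_mono[OF up]) (use p bm in auto)
  have sq: "successively adj (map q (rev [Suc a..<Suc b]))"
    unfolding successively_map successively_rev
    by (rule successively_mono[OF up]) (use q bm adj_sym in auto)
  have lastp: "last (map p [a..<b]) = p (b - 1)" using ab by (simp add: last_map)
  have hdq: "hd (map q (rev [Suc a..<Suc b])) = q b" using ab by (simp add: hd_map)
  have lastq: "last (map q (rev [Suc a..<Suc b])) = q (Suc a)"
    using ab by (simp add: last_map last_rev del: upt_Suc)
  have cyc: "cycle_list adj ?xs"
    unfolding cycle_list_def
  proof (intro conjI)
    show "3 \<le> length ?xs" using ab by simp
    have "inj_on p (set [a..<b])" "inj_on q (set [Suc a..<Suc b])"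
      using bm by (auto intro: inj_on_subset[OF p_inj] inj_on_subset[OF q_inj])
    moreover have "p ` set [a..<b] \<inter> q ` set [Suc a..<Suc b] = {}"
    proof (rule ccontr)
      assume "p ` set [a..<b] \<inter> q ` set [Suc a..<Suc b] \<noteq> {}"
      then obtain i j where ij: "a \<le> i" "i < b" "Suc a \<le> j" "j \<le> b" "p i = q j"
        by (auto simp del: upt_Suc simp: less_Suc_eq_le)
      then have "i = j" using sync[of i j] bm by simp
      then show False using ij a_max[of i] b_min[of i] by (cases "i \<le> h") auto
    qed
    ultimately show "distinct ?xs" by (simp add: distinct_map del: upt_Suc)
    have "adj (p (b - 1)) (q b)" using p[of "b - 1"] b(2) ab bm by simp
    then show "successively adj ?xs"
      unfolding successively_append_iff lastp hdq using sp sq by blast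
    have "adj (q (Suc a)) (q a)" using q[of a] adj_sym ab bm by simp
    then show "adj (last ?xs) (hd ?xs)"
      using ab a(2) lastq by (simp add: hd_map hd_append last_append del: upt_Suc)
  qed
  have "length ?xs = 2 * (b - a)" using ab by (simp del: upt_Suc)
  then show False using no_short[OF cyc] bm m ab by simp
qed

definition long_cycles :: "'a list set" where
  "long_cycles = {xs. cycle_list adj xs \<and> length xs = 2 * k + 1}"

definition coloured_cycles :: "('a \<Rightarrow> nat) \<Rightarrow> 'a list set" where
  "coloured_cycles \<phi> = {xs \<in> long_cycles. \<forall>i<2 * k + 1. \<phi> (xs ! i) = i}"

lemma cycle_list_subset_V:
  assumes "cycle_list adj xs"
  shows "set xs \<subseteq> V"
  using cycle_list_nth_mod[OF assms] adj_V by (fastforce simp: in_set_conv_nth)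

lemma finite_long_cycles: "finite long_cycles"
proof (rule finite_subset)
  show "long_cycles \<subseteq> {xs. set xs \<subseteq> V \<and> length xs = 2 * k + 1}"
    using cycle_list_subset_V by (auto simp: long_cycles_def)
qed (simp add: fin finite_lists_length_eq)

lemma finite_coloured_cycles: "finite (coloured_cycles \<phi>)"
  unfolding coloured_cycles_def using finite_long_cycles by simp

lemma coloured_cyclesD:
  assumes "xs \<in> coloured_cycles \<phi>"
  shows "cycle_list adj xs" "length xs = 2 * k + 1" "distinct xs" "successively adj xs"
    "adj (last xs) (hd xs)"
    "\<And>i. i \<le> 2 * k \<Longrightarrow> \<phi> (xs ! i) = i" "\<And>i. i \<le> 2 * k \<Longrightarrow> xs ! i \<in> V"
    "\<And>i. i < 2 * k \<Longrightarrow> adj (xs ! i) (xs ! Suc i)" "adj (xs ! (2 * k)) (xs ! 0)"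
proof -
  show cyc: "cycle_list adj xs" and len: "length xs = 2 * k + 1"
    using assms by (auto simp: coloured_cycles_def long_cycles_def)
  then show "distinct xs" "successively adj xs" "adj (last xs) (hd xs)"
    by (auto simp: cycle_list_def)
  show "\<And>i. i \<le> 2 * k \<Longrightarrow> \<phi> (xs ! i) = i"
    using assms by (auto simp: coloured_cycles_def)
  show "\<And>i. i \<le> 2 * k \<Longrightarrow> xs ! i \<in> V"
    using cycle_list_subset_V[OF cyc] len by auto
  show "\<And>i. i < 2 * k \<Longrightarrow> adj (xs ! i) (xs ! Suc i)"
    using cycle_list_nth_mod[OF cyc] len by (metis Suc_eq_plus1 Suc_less_eq less_SucI mod_less)
  show "adj (xs ! (2 * k)) (xs ! 0)"
    using cycle_list_nth_mod[OF cyc, of "2 * k"] len by simp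
qed

text \<open>The two arcs from \<open>xs ! 0\<close> to \<open>xs ! k\<close> and from \<open>xs ! (k + 1)\<close> back to \<open>xs ! 0\<close> have length \<open>k\<close>, which
  is short enough for the girth condition to make them unique.\<close>

lemma coloured_cycle_determined:
  assumes xs: "xs \<in> coloured_cycles \<phi>" and ys: "ys \<in> coloured_cycles \<phi>"
    and eq: "xs ! 0 = ys ! 0" "xs ! k = ys ! k" "xs ! (k + 1) = ys ! (k + 1)"
  shows "xs = ys"
proof (rule nth_equalityI)
  note X = coloured_cyclesD[OF xs] and Y = coloured_cyclesD[OF ys]
  show "length xs = length ys" using X Y by simp
  have sync: "i = j" if "zs \<in> {xs, ys}" "zs' \<in> {xs, ys}" "zs ! i = zs' ! j" "i \<le> 2 * k" "j \<le> 2 * k"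
    for zs zs' i j
    using that X(6) Y(6) by (metis insert_iff singletonD)
  have first: "xs ! i = ys ! i" if "i \<le> k" for i
    by (rule sync_walks_eq[of k "(!) xs" "(!) ys"])
      (use X(8) Y(8) eq that in \<open>auto intro!: inj_onI intro: sync\<close>)
  \<comment> \<open>the other arc, from position \<open>k + 1\<close> on and returning to position \<open>0\<close>\<close>
  define f where "f = (\<lambda>zs i. zs ! ((k + 1 + i) mod (2 * k + 1)) :: 'a)"
  have f_less: "f zs i = zs ! (k + 1 + i)" if "i < k" for zs i using that by (simp add: f_def)
  have f_k: "f zs k = zs ! 0" for zs by (simp add: f_def mult_2)
  have f_adj: "adj (f zs i) (f zs (Suc i))" if "i < k" "zs \<in> {xs, ys}" for zs i
  proof (cases "Suc i = k")
    case True
    then have "k + 1 + i = 2 * k" by simp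
    then have "f zs i = zs ! (2 * k)" using f_less[OF that(1), of zs] by metis
    then show ?thesis using True that(2) X(9) Y(9) by (auto simp: f_k)
  next
    case False
    then have "Suc i < k" using that by simp
    then show ?thesis using that X(8)[of "k + 1 + i"] Y(8)[of "k + 1 + i"] by (auto simp: f_less)
  qed
  have f_sync: "i = j" if "zs \<in> {xs, ys}" "zs' \<in> {xs, ys}" "f zs i = f zs' j" "i \<le> k" "j \<le> k"
    for zs zs' i j
  proof -
    have "(k + 1 + i) mod (2 * k + 1) = (k + 1 + j) mod (2 * k + 1)"
      by (rule sync[OF that(1,2)]) (use that(3) in \<open>auto simp: f_def less_Suc_eq_le[symmetric]\<close>)
    then show ?thesis
      using that(4,5) by (cases "i = k"; cases "j = k") (auto simp: mult_2)
  qed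
  have second: "f xs i = f ys i" if "i \<le> k" for i
    by (rule sync_walks_eq[of k "f xs" "f ys"])
      (use f_adj eq that k in \<open>auto intro!: inj_onI intro: f_sync simp: f_k f_less\<close>)
  fix i assume "i < length xs"
  then have i: "i \<le> 2 * k" using X by simp
  show "xs ! i = ys ! i"
  proof (cases "i \<le> k")
    case False
    then have "f zs (i - (k + 1)) = zs ! i" for zs using i by (subst f_less) auto
    then show ?thesis using second[of "i - (k + 1)"] i by simp
  qed (rule first)
qed

text \<open>Otherwise the edges joining colours \<open>k\<close> and \<open>k + 1\<close> in the cycles of \<open>Q\<close> contain a path with
  \<open>2 * s + 1\<close> edges from colour \<open>k\<close> to colour \<open>k + 1\<close>. Arcs of length \<open>k\<close> of two cycles of \<open>Q\<close> join its
  ends to \<open>v\<close>; their colours keep them disjoint from the path and from each other, and the result is a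
  cycle of length \<open>2 * k + 2 * s + 1\<close>.\<close>

lemma coloured_cycles_through_le:
  assumes Q: "Q \<subseteq> coloured_cycles \<phi>" and v: "\<And>xs. xs \<in> Q \<Longrightarrow> xs ! 0 = v"
  shows "card Q \<le> (2 * s + 1) * (card ((\<lambda>xs. xs ! k) ` Q) + card ((\<lambda>xs. xs ! (k + 1)) ` Q))"
proof (rule ccontr)
  let ?A = "(\<lambda>xs. xs ! k) ` Q" and ?B = "(\<lambda>xs. xs ! (k + 1)) ` Q"
  let ?e = "\<lambda>xs. (xs ! k, xs ! (k + 1))"
  assume "\<not> ?thesis"
  moreover have "inj_on ?e Q"
    using Q v coloured_cycle_determined by (fastforce intro!: inj_onI)
  ultimately have dense: "(2 * s + 1) * (card ?A + card ?B) < card (?e ` Q)"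
    by (simp add: card_image)
  have finQ: "finite Q" using Q finite_coloured_cycles finite_subset by blast
  have colA: "x \<in> V \<and> \<phi> x = k" if "x \<in> ?A" for x using that Q coloured_cyclesD(6,7) by fastforce
  have colB: "x \<in> V \<and> \<phi> x = k + 1" if "x \<in> ?B" for x
    using that Q k coloured_cyclesD(6,7)[of _ \<phi> "k + 1"] by auto
  obtain ws where ws: "length ws = Suc (2 * s + 1)" "distinct ws"
    "successively (\<lambda>x y. (x, y) \<in> ?e ` Q \<or> (y, x) \<in> ?e ` Q) ws"
    "\<And>i. i \<le> 2 * s + 1 \<Longrightarrow> ws ! i \<in> (if even i then ?A else ?B)"
  proof (rule bipartite_path[OF _ _ _ _ dense])
    show "?A \<inter> ?B = {}" using colA colB by fastforce
  qed (use finQ in auto)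
  have wsadj: "successively adj ws"
    by (rule successively_mono[OF ws(3)])
      (use Q k coloured_cyclesD(8)[of _ \<phi> k] adj_sym in auto)
  have wscol: "\<phi> x \<in> {k, k + 1}" if "x \<in> set ws" for x
  proof -
    obtain i where i: "i < length ws" "x = ws ! i" using \<open>x \<in> set ws\<close> by (auto simp: in_set_conv_nth)
    then show ?thesis using ws(1) ws(4)[of i] colA colB by (auto split: if_splits)
  qed
  have "ws \<noteq> []" using ws(1) by auto
  have "hd ws \<in> ?A" using ws(1) ws(4)[of 0] \<open>ws \<noteq> []\<close> by (simp add: hd_conv_nth)
  then obtain xs where xs: "xs \<in> Q" "xs ! k = hd ws" by auto
  have "last ws \<in> ?B" using ws(1) ws(4)[of "2 * s + 1"] \<open>ws \<noteq> []\<close> by (simp add: last_conv_nth)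
  then obtain ys where ys: "ys \<in> Q" "ys ! (k + 1) = last ws" by auto
  note X = coloured_cyclesD[OF subsetD[OF Q xs(1)]]
  note Y = coloured_cyclesD[OF subsetD[OF Q ys(1)]]
  \<comment> \<open>\<open>last ws\<close> is the first vertex of the final piece, which keeps that piece nonempty when \<open>k = 1\<close>\<close>
  let ?zs = "take k xs @ butlast ws @ drop (k + 1) ys"
  have "xs \<noteq> []" using X(2) by auto
  then have hdz: "hd ?zs = v" using k v[OF xs(1)] by (simp add: hd_append hd_conv_nth)
  have colx: "\<phi> x < k" if "x \<in> set (take k xs)" for x
    using that X(2,6) by (auto simp: in_set_conv_nth)
  have coly: "k + 1 \<le> \<phi> x" if "x \<in> set (drop (k + 1) ys)" for x
    using that Y(2,6) by (auto simp: in_set_conv_nth)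
  have ws_dec: "ws = butlast ws @ [last ws]" using \<open>ws \<noteq> []\<close> by simp
  have butne: "butlast ws \<noteq> []"
    using ws(1) by (cases ws rule: rev_cases) auto
  have colw: "\<phi> x \<in> {k, k + 1}" if "x \<in> set (butlast ws)" for x
    using that wscol in_set_butlastD by fast
  have drop_ys: "drop (k + 1) ys = last ws # drop (k + 2) ys"
    using Y(2) k ys(2) by (simp add: Cons_nth_drop_Suc[symmetric])
  have "cycle_list adj ?zs"
    unfolding cycle_list_def
  proof (intro conjI)
    show "3 \<le> length ?zs" using ws(1) X(2) Y(2) k by simp
    have "set (butlast ws) \<inter> set (drop (k + 1) ys) = {}"
    proof -
      have "last ws \<notin> set (butlast ws)"
        using ws(2) \<open>ws \<noteq> []\<close> by (cases ws rule: rev_cases) auto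
      moreover have "k + 2 \<le> \<phi> x" if "x \<in> set (drop (k + 2) ys)" for x
        using that Y(2,6) by (auto simp: in_set_conv_nth)
      ultimately show ?thesis using colw unfolding drop_ys by fastforce
    qed
    then show "distinct ?zs"
      using X(3) Y(3) ws(2) colx coly colw by (fastforce simp: distinct_butlast)
    have "successively adj (take k xs @ drop k xs)" using X(4) by simp
    then have 1: "successively adj (take k xs)" "adj (last (take k xs)) (hd (drop k xs))"
      using k X(2) by (auto simp only: successively_append_iff) (auto simp: successively_append_iff)
    have "hd (drop k xs) = hd (butlast ws)"
      using xs(2) X(2) hd_append2[OF butne, of "[last ws]"] ws_dec
      by (simp add: hd_drop_conv_nth)
    moreover have "successively adj (drop (k + 1) ys)"
      using Y(4) successively_append_iff[of adj "take (k + 1) ys" "drop (k + 1) ys"] by simp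
    moreover have "successively adj (butlast ws)" "adj (last (butlast ws)) (last ws)"
      using wsadj butne successively_append_iff[of adj "butlast ws" "[last ws]"] ws_dec
      by simp_all
    ultimately show "successively adj ?zs"
      using 1 butne arg_cong[OF drop_ys, of hd] by (auto simp: successively_append_iff)
    have "last ?zs = last (drop (k + 1) ys)" unfolding drop_ys by simp
    also have "\<dots> = last ys" using Y(2) k by (intro last_drop) simp
    finally have "last ?zs = last ys" .
    moreover have "ys \<noteq> []" using Y(2) by auto
    ultimately show "adj (last ?zs) (hd ?zs)"
      using hdz Y(5) v[OF ys(1)] by (simp add: hd_conv_nth)
  qed
  moreover have "length ?zs = 2 * k + 2 * s + 1" using ws(1) X(2) Y(2) k by simp
  ultimately show False using no_long by blast
qed

text \<open>Rotation moves \<open>v\<close> to the front at the cost of a factor \<open>2 * k + 1\<close>, and a good colouring of the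
  cycles starting at \<open>v\<close> costs another \<open>(2 * k + 1) ^ (2 * k + 1)\<close>.\<close>

lemma long_cycles_through_le:
  "card {xs \<in> long_cycles. v \<in> set xs} \<le> (2 * k + 1) ^ (2 * k + 2) * (2 * s + 1) * n"
proof -
  let ?m = "2 * k + 1"
  define S where "S = {xs \<in> long_cycles. xs ! 0 = v}"
  have finS: "finite S" unfolding S_def using finite_long_cycles by simp
  have "\<exists>\<phi>. card S \<le> ?m ^ ?m * card {xs \<in> S. \<forall>i<?m. \<phi> (xs ! i) = i}"
    by (rule good_colouring[OF fin finS])
      (use cycle_list_subset_V in \<open>auto simp: S_def long_cycles_def cycle_list_def\<close>)
  then obtain \<phi> where \<phi>: "card S \<le> ?m ^ ?m * card {xs \<in> S. \<forall>i<?m. \<phi> (xs ! i) = i}" ..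
  define Q where "Q = {xs \<in> S. \<forall>i<?m. \<phi> (xs ! i) = i}"
  have Q: "Q \<subseteq> coloured_cycles \<phi>" by (auto simp: Q_def S_def coloured_cycles_def)
  let ?A = "(\<lambda>xs. xs ! k) ` Q" and ?B = "(\<lambda>xs. xs ! (k + 1)) ` Q"
  have AB: "?A \<union> ?B \<subseteq> V"
    using Q k coloured_cyclesD(7)[of _ \<phi>] by auto
  have "\<phi> x = k" if "x \<in> ?A" for x using that Q coloured_cyclesD(6) by fastforce
  moreover have "\<phi> x = k + 1" if "x \<in> ?B" for x
    using that Q k coloured_cyclesD(6)[of _ \<phi> "k + 1"] by auto
  ultimately have "?A \<inter> ?B = {}" by fastforce
  then have "card ?A + card ?B = card (?A \<union> ?B)"
    using AB fin by (metis card_Un_disjoint finite_subset le_sup_iff)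
  also have "\<dots> \<le> n" using AB fin by (rule card_mono[rotated])
  finally have "card ?A + card ?B \<le> n" .
  then have "(2 * s + 1) * (card ?A + card ?B) \<le> (2 * s + 1) * n" by (rule mult_le_mono2)
  moreover have "card Q \<le> (2 * s + 1) * (card ?A + card ?B)"
    by (rule coloured_cycles_through_le[OF Q]) (auto simp: Q_def S_def)
  ultimately have "card Q \<le> (2 * s + 1) * n" by (rule order_trans[rotated])
  then have cardS: "card S \<le> ?m ^ ?m * ((2 * s + 1) * n)"
    using \<phi> unfolding Q_def[symmetric] by (meson mult_le_mono2 order_trans)
  have "card {xs \<in> long_cycles. xs ! j = v} \<le> card S" if "j < ?m" for j
  proof (rule card_inj_on_le[where f = "rotate j", OF _ _ finS])
    show "inj_on (rotate j) {xs \<in> long_cycles. xs ! j = v}"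
      unfolding rotate_def by (rule inj_on_subset[OF inj_fn[OF inj_rotate1]]) simp
    show "rotate j ` {xs \<in> long_cycles. xs ! j = v} \<subseteq> S"
      using that by (auto simp: S_def long_cycles_def cycle_list_rotate nth_rotate)
  qed
  then have "(\<Sum>j<?m. card {xs \<in> long_cycles. xs ! j = v}) \<le> (\<Sum>j<?m. card S)"
    by (intro sum_mono) auto
  moreover have split: "{xs \<in> long_cycles. v \<in> set xs} = (\<Union>j<?m. {xs \<in> long_cycles. xs ! j = v})"
    by (auto simp: long_cycles_def in_set_conv_nth)
  have "card {xs \<in> long_cycles. v \<in> set xs} \<le> (\<Sum>j<?m. card {xs \<in> long_cycles. xs ! j = v})"
    unfolding split by (rule card_UN_le) simp
  ultimately have "card {xs \<in> long_cycles. v \<in> set xs} \<le> ?m * card S" by simp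
  also have "\<dots> \<le> ?m * (?m ^ ?m * ((2 * s + 1) * n))" using cardS by (rule mult_le_mono2)
  also have "\<dots> = ?m ^ Suc ?m * (2 * s + 1) * n" by (simp only: power_Suc mult.assoc)
  also have "Suc ?m = 2 * k + 2" by simp
  finally show ?thesis .
qed

end

section \<open>Few vertices reach many\<close>

context odd_cycle_host
begin

text \<open>In the exponents the defects \<open>1 / 3 ^ j\<close> satisfy \<open>1 / 3 ^ j > 2 * (1 / 3 ^ Suc j)\<close>, which is
  what makes heavy vertices rare. They start from \<open>1\<close>, so that \<open>tau 0 = 1\<close> and no vertex of colour \<open>0\<close> is
  heavy. The factor \<open>2 ^ j\<close> gives \<open>2 * tau j \<le> tau (Suc j)\<close> without a lower bound on \<open>n\<close>.\<close>

definition tau :: "nat \<Rightarrow> real" where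
  "tau j = 2 ^ j * real n powr (1 - 1 / 3 ^ j)"

text \<open>For \<open>a\<close> of colour \<open>j\<close>, these are the ends of the paths from \<open>a\<close> down to colour \<open>0\<close> through
  light vertices of the colours \<open>j - 1, \<dots>, 0\<close>. Lightness refers to \<open>reach\<close> at the next smaller
  colour, so it has to be spelled out inside the recursion.\<close>

primrec reach :: "('a \<Rightarrow> nat) \<Rightarrow> nat \<Rightarrow> 'a \<Rightarrow> 'a set" where
  "reach \<phi> 0 a = {a}"
| "reach \<phi> (Suc j) a =
     (\<Union>y \<in> {y. adj a y \<and> \<phi> y = j \<and> real (card (reach \<phi> j y)) \<le> tau j}. reach \<phi> j y)"

definition light :: "('a \<Rightarrow> nat) \<Rightarrow> nat \<Rightarrow> 'a set" where
  "light \<phi> j = {a \<in> V. \<phi> a = j \<and> real (card (reach \<phi> j a)) \<le> tau j}"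

definition heavy :: "('a \<Rightarrow> nat) \<Rightarrow> nat \<Rightarrow> 'a set" where
  "heavy \<phi> j = {a \<in> V. \<phi> a = j \<and> tau j < real (card (reach \<phi> j a))}"

lemma tau_pos: "0 < tau j"
  using n_pos by (simp add: tau_def)

lemma tau_0: "tau 0 = 1"
  using n_pos by (simp add: tau_def)

lemma tau_double: "2 * tau j \<le> tau (Suc j)"
proof -
  have "real n powr (1 - 1 / 3 ^ j) \<le> real n powr (1 - 1 / 3 ^ Suc j)"
    using n_pos by (intro powr_mono) (auto simp: field_simps)
  then show ?thesis by (simp add: tau_def)
qed

lemma finite_light: "finite (light \<phi> j)" and finite_heavy: "finite (heavy \<phi> j)"
  using fin by (simp_all add: light_def heavy_def)

lemma reach_Suc: "reach \<phi> (Suc j) a = (\<Union>y \<in> {y \<in> light \<phi> j. adj a y}. reach \<phi> j y)"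
  using adj_V by (auto simp: light_def)

declare reach.simps(2) [simp del]

lemma reach_subset_V: "a \<in> V \<Longrightarrow> reach \<phi> j a \<subseteq> V"
proof (induction j arbitrary: a)
  case (Suc j)
  then show ?case unfolding reach_Suc by (auto simp: light_def)
qed simp

lemma finite_reach: "a \<in> V \<Longrightarrow> finite (reach \<phi> j a)"
  by (rule finite_subset[OF reach_subset_V fin])

lemma card_reach_Suc_le:
  "real (card (reach \<phi> (Suc j) a)) \<le> real (card {y \<in> light \<phi> j. adj a y}) * tau j"
proof -
  have "card (reach \<phi> (Suc j) a) \<le> (\<Sum>y \<in> {y \<in> light \<phi> j. adj a y}. card (reach \<phi> j y))"
    unfolding reach_Suc by (intro card_UN_le) (simp add: finite_light)
  then have "real (card (reach \<phi> (Suc j) a))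
      \<le> (\<Sum>y \<in> {y \<in> light \<phi> j. adj a y}. real (card (reach \<phi> j y)))"
    by (metis of_nat_le_iff of_nat_sum)
  also have "\<dots> \<le> (\<Sum>y \<in> {y \<in> light \<phi> j. adj a y}. tau j)"
    by (intro sum_mono) (auto simp: light_def)
  finally show ?thesis by simp
qed

lemma reach_path:
  assumes "v \<in> reach \<phi> j a"
  shows "\<exists>p. p 0 = v \<and> p j = a \<and>
    (\<forall>i<j. adj (p i) (p (Suc i)) \<and> \<phi> (p i) = i \<and> v \<in> reach \<phi> i (p i))"
  using assms
proof (induction j arbitrary: a)
  case 0
  then show ?case by (intro exI[of _ "\<lambda>_. v"]) auto
next
  case (Suc j)
  then obtain y where y: "y \<in> light \<phi> j" "adj a y" "v \<in> reach \<phi> j y" unfolding reach_Suc by blast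
  then obtain p where p: "p 0 = v" "p j = y"
    "\<And>i. i < j \<Longrightarrow> adj (p i) (p (Suc i)) \<and> \<phi> (p i) = i \<and> v \<in> reach \<phi> i (p i)"
    using Suc.IH by blast
  then show ?case
    using y adj_sym by (intro exI[of _ "p(Suc j := a)"]) (auto simp: less_Suc_eq light_def)
qed

text \<open>Paths from \<open>a\<close> and from \<open>b\<close> down to \<open>v\<close>, both prolonged to \<open>y\<close>, are two walks of length
  \<open>j + 1 \<le> k\<close> with common ends. The last hypotheses say that \<open>y\<close> cannot be an inner vertex of either: it
  may lie above \<open>a\<close> and \<open>b\<close>, or below them without reaching \<open>v\<close>.\<close>

lemma fork_unique:
  assumes j: "j < k" and a: "\<phi> a = j" "adj y a" and b: "\<phi> b = j" "adj y b"
    and v: "v \<in> reach \<phi> j a" "v \<in> reach \<phi> j b"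
    and y: "\<And>i. i < j \<Longrightarrow> \<phi> y = i \<Longrightarrow> v \<notin> reach \<phi> i y" "\<phi> y \<noteq> j"
  shows "a = b"
proof -
  obtain p where p: "p 0 = v" "p j = a"
    "\<And>i. i < j \<Longrightarrow> adj (p i) (p (Suc i)) \<and> \<phi> (p i) = i \<and> v \<in> reach \<phi> i (p i)"
    using reach_path[OF v(1)] by blast
  obtain q where q: "q 0 = v" "q j = b"
    "\<And>i. i < j \<Longrightarrow> adj (q i) (q (Suc i)) \<and> \<phi> (q i) = i \<and> v \<in> reach \<phi> i (q i)"
    using reach_path[OF v(2)] by blast
  let ?p = "p(Suc j := y)" and ?q = "q(Suc j := y)"
  have colp: "\<phi> (p i) = i \<and> p i \<noteq> y" if "i \<le> j" for i
    using that p a y by (cases "i = j") auto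
  have colq: "\<phi> (q i) = i \<and> q i \<noteq> y" if "i \<le> j" for i
    using that q b y by (cases "i = j") auto
  have "?p j = ?q j"
  proof (rule sync_walks_eq[of "Suc j" ?p ?q j])
    show "Suc j \<le> k" using j by simp
    show "adj (?p i) (?p (Suc i))" if "i < Suc j" for i
      using that p a adj_sym by (cases "i = j") auto
    show "adj (?q i) (?q (Suc i))" if "i < Suc j" for i
      using that q b adj_sym by (cases "i = j") auto
    show sync: "i = i'" if "i \<le> Suc j" "i' \<le> Suc j" "?p i = ?q i'" for i i'
      using that colp[of i] colq[of i'] by (metis fun_upd_apply le_SucE)
    show "inj_on ?p {..Suc j}"
    proof (rule inj_onI)
      fix i i' assume "i \<in> {..Suc j}" "i' \<in> {..Suc j}" "?p i = ?p i'"
      then show "i = i'"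
        using colp[of i] colp[of i'] by (metis atMost_iff fun_upd_apply le_SucE)
    qed
    show "inj_on ?q {..Suc j}"
    proof (rule inj_onI)
      fix i i' assume "i \<in> {..Suc j}" "i' \<in> {..Suc j}" "?q i = ?q i'"
      then show "i = i'"
        using colq[of i] colq[of i'] by (metis atMost_iff fun_upd_apply le_SucE)
    qed
  qed (use p(1) q(1) in auto)
  then show ?thesis using p q by simp
qed

text \<open>A heavy neighbour of \<open>y\<close> reaches at least \<open>tau (Suc j) - tau j \<ge> tau (Suc j) / 2\<close> vertices that
  \<open>y\<close> does not reach, and different heavy neighbours of \<open>y\<close> share none of those, by
  \<open>fork_unique\<close>.\<close>

lemma heavy_neighbours_le:
  assumes j: "Suc j < k" and y: "y \<in> light \<phi> j"
  shows "real (card {a \<in> heavy \<phi> (Suc j). adj a y}) * tau (Suc j) \<le> 2 * real n"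
proof -
  let ?N = "{a \<in> heavy \<phi> (Suc j). adj a y}"
  define S where "S = (\<lambda>a. reach \<phi> (Suc j) a - reach \<phi> j y)"
  have yV: "y \<in> V" "\<phi> y = j" "real (card (reach \<phi> j y)) \<le> tau j" using y by (auto simp: light_def)
  have S_V: "S a \<subseteq> V" if "a \<in> ?N" for a
    using that reach_subset_V by (auto simp: S_def heavy_def)
  have finN: "finite ?N" using finite_heavy by simp
  have S_large: "tau (Suc j) / 2 \<le> real (card (S a))" if "a \<in> ?N" for a
  proof -
    have "card (reach \<phi> (Suc j) a) - card (reach \<phi> j y) \<le> card (S a)"
      unfolding S_def by (rule diff_card_le_card_Diff[OF finite_reach[OF yV(1)]])
    moreover have "tau (Suc j) < real (card (reach \<phi> (Suc j) a))"
      using that by (simp add: heavy_def)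
    ultimately show ?thesis using yV(3) tau_double[of j] by linarith
  qed
  have disj: "S a \<inter> S b = {}" if ab: "a \<in> ?N" "b \<in> ?N" "a \<noteq> b" for a b
  proof (rule ccontr)
    assume "S a \<inter> S b \<noteq> {}"
    then obtain v where v: "v \<in> reach \<phi> (Suc j) a" "v \<in> reach \<phi> (Suc j) b" "v \<notin> reach \<phi> j y"
      by (auto simp: S_def)
    have "a = b"
      by (rule fork_unique[OF j, where y = y and v = v])
        (use ab v yV adj_sym in \<open>auto simp: heavy_def\<close>)
    then show False using ab by simp
  qed
  have "real (card ?N) * (tau (Suc j) / 2) = (\<Sum>a\<in>?N. tau (Suc j) / 2)" by simp
  also have "\<dots> \<le> (\<Sum>a\<in>?N. real (card (S a)))" using S_large by (rule sum_mono)
  also have "\<dots> = real (card (\<Union>a\<in>?N. S a))"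
    using finN S_V fin disj by (subst card_UN_disjoint) (auto intro: finite_subset)
  also have "\<dots> \<le> real n" using S_V fin by (intro of_nat_mono card_mono) auto
  finally show ?thesis by simp
qed

text \<open>Count the edges between the heavy vertices of colour \<open>Suc j\<close> and the light ones of colour \<open>j\<close>: every
  heavy vertex has at least \<open>tau (Suc j) / tau j\<close> light neighbours, every light vertex has at most
  \<open>2 * n / tau (Suc j)\<close> heavy ones.\<close>

lemma card_heavy_le:
  assumes j: "Suc j < k"
  shows "real (card (heavy \<phi> (Suc j))) \<le> real n powr (1 - 1 / 3 ^ Suc j)"
proof -
  let ?H = "heavy \<phi> (Suc j)" and ?L = "light \<phi> j"
  have "real (card ?H) * (tau (Suc j) / tau j) = (\<Sum>a\<in>?H. tau (Suc j) / tau j)" by simp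
  also have "\<dots> \<le> (\<Sum>a\<in>?H. real (card {y \<in> ?L. adj a y}))"
  proof (rule sum_mono)
    fix a assume "a \<in> ?H"
    then have "tau (Suc j) \<le> real (card {y \<in> ?L. adj a y}) * tau j"
      using card_reach_Suc_le[of \<phi> j a] by (simp add: heavy_def)
    then show "tau (Suc j) / tau j \<le> real (card {y \<in> ?L. adj a y})"
      using tau_pos by (simp add: pos_divide_le_eq)
  qed
  also have "\<dots> = (\<Sum>y\<in>?L. real (card {a \<in> ?H. adj a y}))"
    using sum_multicount_gen[OF finite_heavy[of \<phi> "Suc j"] finite_light[of \<phi> j], of adj]
    by (simp flip: of_nat_sum)
  also have "\<dots> \<le> (\<Sum>y\<in>?L. 2 * real n / tau (Suc j))"
    using heavy_neighbours_le[OF j] tau_pos by (intro sum_mono) (simp add: pos_le_divide_eq)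
  also have "\<dots> = real (card ?L) * (2 * real n / tau (Suc j))" by simp
  also have "\<dots> \<le> real n * (2 * real n / tau (Suc j))"
    using tau_pos[of "Suc j"] fin
    by (intro mult_right_mono) (auto simp: light_def intro!: card_mono)
  finally have "real (card ?H) \<le> 2 * (real n)\<^sup>2 * tau j / (tau (Suc j))\<^sup>2"
    using tau_pos[of j] tau_pos[of "Suc j"] by (simp add: field_simps power2_eq_square)
  also have "\<dots> = real n powr (1 - 1 / 3 ^ Suc j) / 2 ^ Suc j"
  proof -
    define d :: real where "d = 1 / 3 ^ Suc j"
    have d3: "1 / 3 ^ j = 3 * d" by (simp add: d_def)
    have n0: "0 < real n" using n_pos by simp
    have "(real n)\<^sup>2 * real n powr (1 - 3 * d) = real n powr (2 + (1 - 3 * d))"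
      using n0 powr_add[of "real n" 2 "1 - 3 * d"] by simp
    also have "\<dots> = real n powr ((1 - d) + (1 - d) + (1 - d))" by simp
    also have "\<dots> = real n powr (1 - d) * (real n powr (1 - d))\<^sup>2"
      by (simp only: powr_add power2_eq_square mult.assoc)
    finally have "(real n)\<^sup>2 * real n powr (1 - 3 * d) = real n powr (1 - d) * (real n powr (1 - d))\<^sup>2" .
    then show ?thesis
      using n0 unfolding tau_def d3 d_def[symmetric]
      by (simp add: field_simps power2_eq_square)
  qed
  also have "\<dots> \<le> real n powr (1 - 1 / 3 ^ Suc j)"
    using mult_left_mono[OF one_le_power[of "2::real" "Suc j"], of "real n powr (1 - 1 / 3 ^ Suc j)"]
    by (simp add: divide_le_eq)
  finally show ?thesis .
qed

end

section \<open>Pairs of opposite vertices\<close>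

context odd_cycle_host
begin

definition heavies :: "('a \<Rightarrow> nat) \<Rightarrow> 'a set" where
  "heavies \<phi> = (\<Union>j\<in>{1..<k}. heavy \<phi> j)"

definition light_cycles :: "('a \<Rightarrow> nat) \<Rightarrow> 'a list set" where
  "light_cycles \<phi> = {xs \<in> coloured_cycles \<phi>. set xs \<inter> heavies \<phi> = {}}"

definition opposite_pairs :: "('a \<Rightarrow> nat) \<Rightarrow> ('a \<times> 'a) set" where
  "opposite_pairs \<phi> = (\<lambda>xs. (xs ! 0, xs ! k)) ` light_cycles \<phi>"

lemma finite_heavies: "finite (heavies \<phi>)"
  by (simp add: heavies_def finite_heavy)

lemma finite_opposite_pairs: "finite (opposite_pairs \<phi>)"
  using finite_coloured_cycles by (simp add: opposite_pairs_def light_cycles_def)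

lemma card_heavies_le: "real (card (heavies \<phi>)) \<le> real k * real n powr (1 - 1 / 3 ^ k)"
proof -
  have "real (card (heavies \<phi>)) \<le> (\<Sum>j\<in>{1..<k}. real (card (heavy \<phi> j)))"
    unfolding heavies_def by (metis card_UN_le finite_atLeastLessThan of_nat_le_iff of_nat_sum)
  also have "\<dots> \<le> (\<Sum>j\<in>{1..<k}. real n powr (1 - 1 / 3 ^ k))"
  proof (rule sum_mono)
    fix j assume j: "j \<in> {1..<k}"
    then obtain i where i: "j = Suc i" by (cases j) auto
    have "real n powr (1 - 1 / 3 ^ j) \<le> real n powr (1 - 1 / 3 ^ k)"
      using n_pos j by (intro powr_mono) (auto intro!: divide_left_mono power_increasing)
    then show "real (card (heavy \<phi> j)) \<le> real n powr (1 - 1 / 3 ^ k)"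
      using card_heavy_le[of i \<phi>] i j by simp
  qed
  also have "\<dots> = real (k - 1) * real n powr (1 - 1 / 3 ^ k)" by simp
  also have "\<dots> \<le> real k * real n powr (1 - 1 / 3 ^ k)" by (intro mult_right_mono) auto
  finally show ?thesis .
qed

lemma light_cycle_light:
  assumes xs: "xs \<in> light_cycles \<phi>" and i: "i < k"
  shows "xs ! i \<in> light \<phi> i"
proof -
  have C: "xs \<in> coloured_cycles \<phi>" using xs by (simp add: light_cycles_def)
  note X = coloured_cyclesD[OF C]
  show ?thesis
  proof (cases "i = 0")
    case True
    then show ?thesis using X(6,7)[of 0] by (simp add: light_def tau_0)
  next
    case False
    then have "heavy \<phi> i \<subseteq> heavies \<phi>" using i
      unfolding heavies_def by (intro UN_upper) simp
    moreover have "xs ! i \<in> set xs" using X(2) i by simp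
    ultimately have "xs ! i \<notin> heavy \<phi> i"
      using xs by (auto simp: light_cycles_def)
    then show ?thesis using X(6,7)[of i] i by (auto simp: light_def heavy_def)
  qed
qed

lemma light_cycle_reach:
  assumes xs: "xs \<in> light_cycles \<phi>" and i: "i \<le> k"
  shows "xs ! 0 \<in> reach \<phi> i (xs ! i)"
  using i
proof (induction i)
  case (Suc i)
  have "xs \<in> coloured_cycles \<phi>" using xs by (simp add: light_cycles_def)
  then have "adj (xs ! Suc i) (xs ! i)"
    using coloured_cyclesD(8) adj_sym Suc.prems k by simp
  then show ?case
    unfolding reach_Suc using Suc light_cycle_light[OF xs, of i] by auto
qed simp

text \<open>The edges that go to vertices reaching \<open>v\<close> number at most one for each \<open>w\<close>, by \<open>fork_unique\<close>. The
  remaining ones form a graph \<open>F\<close>. A path with \<open>2 * s\<close> edges in \<open>F\<close> that starts and ends at vertices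
  opposite to \<open>v\<close> is disjoint from the arc of length \<open>k\<close> from \<open>v\<close> to its first vertex, because that arc
  passes colour \<open>k - 1\<close> at a vertex which reaches \<open>v\<close>. It is disjoint from the arc of length
  \<open>k + 1\<close> from its last vertex back to \<open>v\<close> by colours. Together they make a cycle of length
  \<open>2 * k + 2 * s + 1\<close>.\<close>

lemma light_edges_le:
  "(\<Sum>w \<in> {w. (v, w) \<in> opposite_pairs \<phi>}. card {a \<in> light \<phi> (k - 1). adj w a})
    \<le> (2 * s + 1) * n"
proof -
  let ?A = "{w. (v, w) \<in> opposite_pairs \<phi>}" and ?L = "light \<phi> (k - 1)"
  define F where "F = {(w, a). w \<in> ?A \<and> a \<in> ?L \<and> adj w a \<and> v \<notin> reach \<phi> (k - 1) a}"
  have A: "\<exists>xs \<in> light_cycles \<phi>. xs ! 0 = v \<and> xs ! k = w" if "w \<in> ?A" for w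
    using that by (auto simp: opposite_pairs_def)
  have light_coloured: "xs \<in> coloured_cycles \<phi>" if "xs \<in> light_cycles \<phi>" for xs
    using that by (simp add: light_cycles_def)
  have colA: "w \<in> V \<and> \<phi> w = k \<and> v \<in> reach \<phi> k w" if w: "w \<in> ?A" for w
  proof -
    obtain xs where xs: "xs \<in> light_cycles \<phi>" "xs ! 0 = v" "xs ! k = w" using A[OF w] by blast
    show ?thesis
      using coloured_cyclesD(6,7)[OF light_coloured[OF xs(1)], of k] light_cycle_reach[OF xs(1), of k] xs
      by auto
  qed
  have colL: "a \<in> V \<and> \<phi> a = k - 1" if "a \<in> ?L" for a using that by (simp add: light_def)
  have finA: "finite ?A" by (rule finite_subset[OF _ fin]) (use colA in auto)
  have "w \<notin> ?L" if "w \<in> ?A" for w using colA[OF that] colL[of w] k by auto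
  then have disj: "?A \<inter> ?L = {}" by blast
  have "card ?A + card ?L = card (?A \<union> ?L)"
    using finA finite_light disj by (simp add: card_Un_disjoint)
  also have "\<dots> \<le> n" using colA colL fin by (intro card_mono) auto
  finally have AL: "card ?A + card ?L \<le> n" .
  have "card F \<le> 2 * s * (card ?A + card ?L)"
  proof (rule ccontr)
    assume "\<not> card F \<le> 2 * s * (card ?A + card ?L)"
    then have dense: "2 * s * (card ?A + card ?L) < card F" by simp
    have "F \<subseteq> ?A \<times> ?L" by (auto simp: F_def)
    then obtain ws where ws: "length ws = Suc (2 * s)" "distinct ws"
      "successively (\<lambda>x y. (x, y) \<in> F \<or> (y, x) \<in> F) ws"
      "\<And>i. i \<le> 2 * s \<Longrightarrow> ws ! i \<in> (if even i then ?A else ?L)"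
      using bipartite_path[OF finA finite_light disj _ dense] by blast
    have wsadj: "successively adj ws"
      by (rule successively_mono[OF ws(3)]) (auto simp: F_def adj_sym)
    have "ws \<noteq> []" using ws(1) by auto
    then have "hd ws \<in> ?A" "last ws \<in> ?A"
      using ws(1) ws(4)[of 0] ws(4)[of "2 * s"] by (simp_all add: hd_conv_nth last_conv_nth)
    then obtain xs ys where xs: "xs \<in> light_cycles \<phi>" "xs ! 0 = v" "xs ! k = hd ws"
      and ys: "ys \<in> light_cycles \<phi>" "ys ! 0 = v" "ys ! k = last ws"
      using A by blast
    note X = coloured_cyclesD[OF light_coloured[OF xs(1)]]
    note Y = coloured_cyclesD[OF light_coloured[OF ys(1)]]
    let ?zs = "take k xs @ ws @ drop (k + 1) ys"
    have "xs \<noteq> []" "ys \<noteq> []" using X(2) Y(2) by auto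
    then have hdz: "hd ?zs = v" using k xs(2) by (simp add: hd_append hd_conv_nth)
    have colx: "\<phi> x < k" "x \<in> V" "v \<in> reach \<phi> (\<phi> x) x" if "x \<in> set (take k xs)" for x
      using that X(2,6,7) light_cycle_reach[OF xs(1)] xs(2) by (auto simp: in_set_conv_nth)
    have coly: "k + 1 \<le> \<phi> x" if "x \<in> set (drop (k + 1) ys)" for x
      using that Y(2,6) by (auto simp: in_set_conv_nth)
    \<comment> \<open>for \<open>s = 0\<close> the path would be a single vertex, lying on no edge\<close>
    have edge: "\<exists>y. (x, y) \<in> F \<or> (y, x) \<in> F" if x: "x \<in> set ws" "length ws > 1" for x
    proof -
      obtain i where i: "i < length ws" "x = ws ! i" using x(1) by (auto simp: in_set_conv_nth)
      show ?thesis
      proof (cases "Suc i < length ws")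
        case True
        then show ?thesis using successively_nth[OF ws(3)] i by blast
      next
        case False
        then have "i = Suc (i - 1)" using i x(2) by simp
        then show ?thesis using successively_nth[OF ws(3), of "i - 1"] i by metis
      qed
    qed
    have colw: "\<phi> x = k \<or> (\<phi> x = k - 1 \<and> v \<notin> reach \<phi> (k - 1) x)" if x: "x \<in> set ws" for x
    proof (cases "length ws > 1")
      case True
      then show ?thesis using edge[OF x] colA by (fastforce simp: F_def light_def)
    next
      case False
      then have "ws = [hd ws]" using \<open>ws \<noteq> []\<close> by (cases ws) auto
      then have "x = hd ws" using x by (metis empty_iff insert_iff list.set)
      then show ?thesis using \<open>hd ws \<in> ?A\<close> colA by auto
    qed
    have "cycle_list adj ?zs"
      unfolding cycle_list_def
    proof (intro conjI)
      show "3 \<le> length ?zs" using ws(1) X(2) Y(2) k by simp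
      have "x \<notin> set ws" if "x \<in> set (take k xs)" for x
        using colx[OF that] colw[of x] by auto
      moreover have "x \<notin> set (drop (k + 1) ys)" if "x \<in> set (take k xs)" for x
        using colx(1)[OF that] coly[of x] by auto
      moreover have "x \<notin> set (drop (k + 1) ys)" if "x \<in> set ws" for x
        using colw[OF that] coly[of x] by auto
      ultimately show "distinct ?zs"
        using X(3) Y(3) ws(2) unfolding distinct_append set_append
        by (intro conjI distinct_take distinct_drop) blast+
      have "successively adj (take k xs)" "adj (last (take k xs)) (hd (drop k xs))"
        using X(2,4) k \<open>xs \<noteq> []\<close> successively_append_iff[of adj "take k xs" "drop k xs"] by auto
      moreover have "hd (drop k xs) = hd ws" using xs(3) X(2) by (simp add: hd_drop_conv_nth)
      moreover have "take (k + 1) ys \<noteq> []" "drop (k + 1) ys \<noteq> []" using \<open>ys \<noteq> []\<close> Y(2) k by auto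
      then have "successively adj (drop (k + 1) ys)" "adj (last (take (k + 1) ys)) (hd (drop (k + 1) ys))"
        using Y(4) successively_append_iff[of adj "take (k + 1) ys" "drop (k + 1) ys"] by auto
      moreover have "last (take (k + 1) ys) = last ws"
        using ys(3) Y(2) by (simp add: take_Suc_conv_app_nth)
      ultimately show "successively adj ?zs"
        using wsadj \<open>ws \<noteq> []\<close> by (auto simp: successively_append_iff)
      have "last ?zs = last (drop (k + 1) ys)" using Y(2) k by (simp add: last_append)
      also have "\<dots> = last ys" using Y(2) k by (intro last_drop) simp
      finally show "adj (last ?zs) (hd ?zs)"
        using hdz Y(5) ys(2) \<open>ys \<noteq> []\<close> by (simp add: hd_conv_nth)
    qed
    moreover have "length ?zs = 2 * k + 2 * s + 1" using ws(1) X(2) Y(2) k by simp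
    ultimately show False using no_long by blast
  qed
  also have "\<dots> \<le> 2 * s * n" using AL by (rule mult_le_mono2)
  finally have cardF: "card F \<le> 2 * s * n" .
  have finF: "finite {a. (w, a) \<in> F}" for w
    by (rule finite_subset[OF _ finite_light[of \<phi> "k - 1"]]) (auto simp: F_def)
  have deg: "card {a \<in> ?L. adj w a} \<le> card {a. (w, a) \<in> F} + 1" if w: "w \<in> ?A" for w
  proof -
    let ?U = "{a \<in> ?L. adj w a \<and> v \<in> reach \<phi> (k - 1) a}"
    have "a = b" if "a \<in> ?U" "b \<in> ?U" for a b
      by (rule fork_unique[of "k - 1" \<phi> a w b v])
        (use that colA[OF w] colL k in auto)
    then have "card ?U \<le> 1"
      using finite_light[of \<phi> "k - 1"] by (subst One_nat_def, subst card_le_Suc0_iff_eq) auto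
    moreover have "{a \<in> ?L. adj w a} = {a. (w, a) \<in> F} \<union> ?U" using w by (auto simp: F_def)
    ultimately show ?thesis
      using card_Un_le[of "{a. (w, a) \<in> F}" ?U] by simp
  qed
  have "(\<Sum>w\<in>?A. card {a \<in> ?L. adj w a}) \<le> (\<Sum>w\<in>?A. card {a. (w, a) \<in> F} + 1)"
    using deg by (rule sum_mono)
  also have "\<dots> = (\<Sum>w\<in>?A. card {a. (w, a) \<in> F}) + card ?A"
    by (simp only: sum.distrib) simp
  also have "(\<Sum>w\<in>?A. card {a. (w, a) \<in> F}) = card (SIGMA w:?A. {a. (w, a) \<in> F})"
    using finA finF by simp
  also have "(SIGMA w:?A. {a. (w, a) \<in> F}) = F" by (auto simp: F_def)
  also have "card F + card ?A \<le> 2 * s * n + n" using cardF AL by simp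
  finally show ?thesis by simp
qed

text \<open>With \<open>g w\<close> the number of pairs containing \<open>w\<close> and \<open>deg w\<close> its number of light neighbours,
  \<open>g w \<le> deg w * tau (k - 1)\<close>, while \<open>light_edges_le\<close> bounds the sum of \<open>g w * deg w\<close>. Hence
  the sum of the squares of the \<open>g w\<close> is small, and Cauchy-Schwarz bounds the sum of the \<open>g w\<close>.\<close>

lemma card_opposite_pairs_le:
  "real (card (opposite_pairs \<phi>)) \<le> real ((2 * s + 1) * 2 ^ k) * real n powr (2 - 1 / 3 ^ k)"
proof -
  let ?P = "opposite_pairs \<phi>"
  define deg where "deg w = real (card {a \<in> light \<phi> (k - 1). adj w a})" for w
  define g where "g w = card {v \<in> V. (v, w) \<in> ?P}" for w
  have PV: "v \<in> V \<and> w \<in> V \<and> v \<in> reach \<phi> k w" if vw: "(v, w) \<in> ?P" for v w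
  proof -
    obtain xs where xs: "xs \<in> light_cycles \<phi>" "xs ! 0 = v" "xs ! k = w"
      using vw by (auto simp: opposite_pairs_def)
    then have "xs \<in> coloured_cycles \<phi>" by (simp add: light_cycles_def)
    then show ?thesis
      using coloured_cyclesD(7)[of xs \<phi> 0] coloured_cyclesD(7)[of xs \<phi> k]
        light_cycle_reach[OF xs(1), of k] xs by auto
  qed
  have g_le: "real (g w) \<le> deg w * tau (k - 1)" if w: "w \<in> V" for w
  proof -
    have "g w \<le> card (reach \<phi> k w)"
      unfolding g_def using PV finite_reach[OF w] by (intro card_mono) auto
    then show ?thesis
      using card_reach_Suc_le[of \<phi> "k - 1" w] k by (simp add: deg_def)
  qed
  have card_P: "card ?P = (\<Sum>w\<in>V. g w)"
  proof -
    have "?P\<inverse> = (SIGMA w:V. {v \<in> V. (v, w) \<in> ?P})" using PV by auto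
    then have "card ?P = card (SIGMA w:V. {v \<in> V. (v, w) \<in> ?P})" by (metis card_inverse)
    then show ?thesis unfolding g_def using fin by (simp add: card_SigmaI)
  qed
  have "(\<Sum>w\<in>V. real (g w) * deg w) = (\<Sum>w\<in>V. \<Sum>v\<in>V. if (v, w) \<in> ?P then deg w else 0)"
    using fin by (simp add: g_def sum.If_cases Int_def)
  also have "\<dots> = (\<Sum>v\<in>V. \<Sum>w\<in>V. if (v, w) \<in> ?P then deg w else 0)" by (rule sum.swap)
  also have "\<dots> = (\<Sum>v\<in>V. \<Sum>w\<in>{w. (v, w) \<in> ?P}. deg w)"
  proof (rule sum.cong[OF refl])
    fix v
    have "V \<inter> {w. (v, w) \<in> ?P} = {w. (v, w) \<in> ?P}" using PV by auto
    then show "(\<Sum>w\<in>V. if (v, w) \<in> ?P then deg w else 0) = (\<Sum>w\<in>{w. (v, w) \<in> ?P}. deg w)"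
      using fin by (simp add: sum.If_cases)
  qed
  also have "\<dots> \<le> (\<Sum>v\<in>V. real ((2 * s + 1) * n))"
    unfolding deg_def of_nat_sum[symmetric] of_nat_le_iff
    by (intro sum_mono light_edges_le)
  finally have gdeg: "(\<Sum>w\<in>V. real (g w) * deg w) \<le> real (2 * s + 1) * (real n)\<^sup>2"
    by (simp add: power2_eq_square algebra_simps)
  let ?e = "1 / 3 ^ k :: real"
  have n1: "1 \<le> real n" using n_pos by simp
  have tau_le: "tau (k - 1) \<le> 2 ^ k * real n powr (1 - 2 * ?e)"
  proof -
    have "(3::real) ^ k = 3 * 3 ^ (k - 1)" using k by (cases k) auto
    then have "2 * ?e \<le> 1 / 3 ^ (k - 1)" by (simp add: field_simps)
    then have "real n powr (1 - 1 / 3 ^ (k - 1)) \<le> real n powr (1 - 2 * ?e)"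
      using n1 by (intro powr_mono) auto
    then show ?thesis unfolding tau_def by (intro mult_mono power_increasing) auto
  qed
  have "(real (card ?P))\<^sup>2 \<le> (\<Sum>w\<in>V. (real (g w))\<^sup>2) * real n"
    unfolding card_P using sum_squared_le_sum_of_squares[of "\<lambda>w. real (g w)" V] by simp
  also have "(\<Sum>w\<in>V. (real (g w))\<^sup>2) \<le> (\<Sum>w\<in>V. real (g w) * deg w * tau (k - 1))"
    unfolding power2_eq_square mult.assoc using g_le by (intro sum_mono mult_left_mono) auto
  also have "\<dots> = tau (k - 1) * (\<Sum>w\<in>V. real (g w) * deg w)"
    by (simp add: sum_distrib_left mult_ac)
  also have "\<dots> \<le> tau (k - 1) * (real (2 * s + 1) * (real n)\<^sup>2)"
    using gdeg tau_pos[of "k - 1"] by (intro mult_left_mono) auto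
  finally have "(real (card ?P))\<^sup>2 \<le> tau (k - 1) * real (2 * s + 1) * real n ^ 3"
    by (simp add: mult_right_mono mult_ac power2_eq_square power3_eq_cube)
  also have "\<dots> \<le> 2 ^ k * real n powr (1 - 2 * ?e) * real (2 * s + 1) * real n ^ 3"
    using tau_le by (intro mult_right_mono) simp_all
  also have "2 ^ k * real n powr (1 - 2 * ?e) * real (2 * s + 1) * real n ^ 3
      = real ((2 * s + 1) * 2 ^ k) * (real n powr (2 - ?e))\<^sup>2"
  proof -
    have "real n powr (1 - 2 * ?e) * real n ^ 3 = real n powr ((1 - 2 * ?e) + 3)"
      using n1 powr_add[of "real n" "1 - 2 * ?e" 3] by simp
    also have "\<dots> = real n powr ((2 - ?e) + (2 - ?e))" by simp
    also have "\<dots> = (real n powr (2 - ?e))\<^sup>2" by (simp only: powr_add power2_eq_square)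
    finally have E: "real n powr (1 - 2 * ?e) * real n ^ 3 = (real n powr (2 - ?e))\<^sup>2" .
    have "2 ^ k * real n powr (1 - 2 * ?e) * real (2 * s + 1) * real n ^ 3
        = real ((2 * s + 1) * 2 ^ k) * (real n powr (1 - 2 * ?e) * real n ^ 3)"
      by (simp add: algebra_simps)
    then show ?thesis unfolding E .
  qed
  also have "\<dots> \<le> (real ((2 * s + 1) * 2 ^ k))\<^sup>2 * (real n powr (2 - ?e))\<^sup>2"
  proof (rule mult_right_mono)
    have "1 \<le> (2 * s + 1) * 2 ^ k" by (simp add: Suc_le_eq)
    then have "1 \<le> real ((2 * s + 1) * 2 ^ k)" by (metis of_nat_1 of_nat_le_iff)
    then show "real ((2 * s + 1) * 2 ^ k) \<le> (real ((2 * s + 1) * 2 ^ k))\<^sup>2"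
      by (simp only: power2_eq_square mult_le_cancel_left1) simp
  qed simp
  also have "\<dots> = (real ((2 * s + 1) * 2 ^ k) * real n powr (2 - ?e))\<^sup>2"
    by (simp only: power_mult_distrib)
  finally show ?thesis by (rule power2_le_imp_le) (rule mult_nonneg_nonneg, simp_all)
qed

end

section \<open>Counting all cycles of length 2k+1\<close>

context odd_cycle_host
begin

definition reflect :: "('a \<Rightarrow> nat) \<Rightarrow> 'a \<Rightarrow> nat" where
  "reflect \<phi> x = (2 * k + 1 - \<phi> x) mod (2 * k + 1)"

lemma reflect_coloured_cycle:
  assumes "xs \<in> coloured_cycles \<phi>"
  shows "hd xs # rev (tl xs) \<in> coloured_cycles (reflect \<phi>)"
proof -
  note X = coloured_cyclesD[OF assms]
  obtain x ys where xs: "xs = x # ys" "ys \<noteq> []" using X(2) k by (cases xs; cases "tl xs") auto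
  have "cycle_list adj (x # rev ys)"
    using X(1) xs(2) adj_sym
    by (auto simp: xs(1) cycle_list_def successively_Cons hd_rev last_rev intro: successively_mono)
  moreover have "reflect \<phi> ((x # rev ys) ! i) = i" if i: "i < 2 * k + 1" for i
  proof (cases i)
    case 0
    then show ?thesis using X(6)[of 0] xs(1) by (simp add: reflect_def)
  next
    case (Suc j)
    then have "(x # rev ys) ! i = xs ! (2 * k - j)"
      using i X(2) by (simp add: xs(1) rev_nth nth_Cons' Suc_diff_Suc)
    then show ?thesis using X(6)[of "2 * k - j"] i Suc by (simp add: reflect_def)
  qed
  ultimately show ?thesis
    using X(2) by (simp add: coloured_cycles_def long_cycles_def xs(1))
qed

text \<open>A dense graph of edges \<open>x\<^sub>k x\<^sub>k\<^sub>+\<^sub>1\<close> may have very few end points of colour \<open>k\<close>, so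
  \<open>coloured_cycles_through_le\<close> needs both kinds of end points to be bounded; those of colour
  \<open>k + 1\<close> have colour \<open>k\<close> in the reflected colouring.\<close>

lemma card_light_cycles_le:
  "real (card (light_cycles \<phi> \<inter> {xs. set xs \<inter> heavies (reflect \<phi>) = {}}))
    \<le> real ((2 * s + 1) * (2 * ((2 * s + 1) * 2 ^ k))) * real n powr (2 - 1 / 3 ^ k)"
proof -
  define Q where "Q = light_cycles \<phi> \<inter> {xs. set xs \<inter> heavies (reflect \<phi>) = {}}"
  define Qv where "Qv v = {xs \<in> Q. xs ! 0 = v}" for v
  have Q: "Q \<subseteq> coloured_cycles \<phi>" by (auto simp: Q_def light_cycles_def)
  then have finQ: "finite Q" using finite_coloured_cycles finite_subset by blast
  let ?A = "\<lambda>v. (\<lambda>xs. xs ! k) ` Qv v" and ?B = "\<lambda>v. (\<lambda>xs. xs ! (k + 1)) ` Qv v"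
  have finAB: "finite (?A v)" "finite (?B v)" for v using finQ by (simp_all add: Qv_def)
  have "(SIGMA v:V. ?A v) \<subseteq> opposite_pairs \<phi>"
    by (auto simp: Qv_def Q_def opposite_pairs_def)
  then have "card (SIGMA v:V. ?A v) \<le> card (opposite_pairs \<phi>)"
    by (rule card_mono[OF finite_opposite_pairs])
  then have A: "(\<Sum>v\<in>V. card (?A v)) \<le> card (opposite_pairs \<phi>)"
    using fin finAB by simp
  have "(SIGMA v:V. ?B v) \<subseteq> opposite_pairs (reflect \<phi>)"
  proof clarsimp
    fix xs v assume xs: "xs \<in> Qv v"
    then have C: "xs \<in> coloured_cycles \<phi>" using Q by (auto simp: Qv_def)
    let ?ys = "hd xs # rev (tl xs)"
    have "xs \<noteq> []" using coloured_cyclesD(2)[OF C] by auto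
    then have "set ?ys = set xs" by (cases xs) auto
    then have "?ys \<in> light_cycles (reflect \<phi>)"
      using reflect_coloured_cycle[OF C] xs by (simp add: light_cycles_def Qv_def Q_def)
    moreover have "?ys ! 0 = v" using xs \<open>xs \<noteq> []\<close> by (simp add: Qv_def hd_conv_nth)
    moreover have "?ys ! k = xs ! Suc k"
      using coloured_cyclesD(2)[OF C] k by (simp add: nth_Cons' rev_nth nth_tl)
    ultimately show "(v, xs ! Suc k) \<in> opposite_pairs (reflect \<phi>)"
      unfolding opposite_pairs_def by (metis (mono_tags, lifting) image_eqI)
  qed
  then have "card (SIGMA v:V. ?B v) \<le> card (opposite_pairs (reflect \<phi>))"
    by (rule card_mono[OF finite_opposite_pairs])
  then have B: "(\<Sum>v\<in>V. card (?B v)) \<le> card (opposite_pairs (reflect \<phi>))"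
    using fin finAB by simp
  have "Q = (\<Union>v\<in>V. Qv v)" using Q coloured_cyclesD(7)[of _ \<phi> 0] by (auto simp: Qv_def)
  then have "card Q \<le> (\<Sum>v\<in>V. card (Qv v))" using card_UN_le[OF fin] by metis
  also have "\<dots> \<le> (\<Sum>v\<in>V. (2 * s + 1) * (card (?A v) + card (?B v)))"
    by (intro sum_mono coloured_cycles_through_le[of _ \<phi>]) (use Q in \<open>auto simp: Qv_def\<close>)
  also have "\<dots> = (2 * s + 1) * ((\<Sum>v\<in>V. card (?A v)) + (\<Sum>v\<in>V. card (?B v)))"
    by (simp only: sum_distrib_left[symmetric] sum.distrib)
  also have "\<dots> \<le> (2 * s + 1) * (card (opposite_pairs \<phi>) + card (opposite_pairs (reflect \<phi>)))"
    by (intro mult_le_mono2 add_mono A B)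
  finally have "real (card Q)
      \<le> real (2 * s + 1) * (real (card (opposite_pairs \<phi>)) + real (card (opposite_pairs (reflect \<phi>))))"
    by (metis of_nat_add of_nat_le_iff of_nat_mult)
  also have "\<dots> \<le> real (2 * s + 1) * (real ((2 * s + 1) * 2 ^ k) * real n powr (2 - 1 / 3 ^ k)
      + real ((2 * s + 1) * 2 ^ k) * real n powr (2 - 1 / 3 ^ k))"
    by (intro mult_left_mono add_mono card_opposite_pairs_le) simp
  also have "\<dots> = real ((2 * s + 1) * (2 * ((2 * s + 1) * 2 ^ k))) * real n powr (2 - 1 / 3 ^ k)"
    by (simp add: algebra_simps)
  finally show ?thesis unfolding Q_def .
qed

text \<open>The two sets of heavy vertices have \<open>O(n\<^bsup>1-\<epsilon>\<^esup>)\<close> elements, each on \<open>O(n)\<close> cycles; the other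
  coloured cycles are those of \<open>card_light_cycles_le\<close>.\<close>

lemma card_long_cycles_le:
  "real (card long_cycles) \<le> real ((2 * k + 1) ^ (2 * k + 1) *
      (2 * k * ((2 * k + 1) ^ (2 * k + 2) * (2 * s + 1)) + (2 * s + 1) * (2 * ((2 * s + 1) * 2 ^ k))))
    * real n powr (2 - 1 / 3 ^ k)"
proof -
  let ?m = "2 * k + 1" and ?a = "(2 * k + 1) ^ (2 * k + 2) * (2 * s + 1)"
    and ?b = "(2 * s + 1) * (2 * ((2 * s + 1) * 2 ^ k))" and ?e = "1 / 3 ^ k :: real"
  have "\<exists>\<phi>. card long_cycles \<le> ?m ^ ?m * card {xs \<in> long_cycles. \<forall>i<?m. \<phi> (xs ! i) = i}"
    by (rule good_colouring[OF fin finite_long_cycles])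
      (use cycle_list_subset_V in \<open>auto simp: long_cycles_def cycle_list_def\<close>)
  then obtain \<phi> where \<phi>: "card long_cycles \<le> ?m ^ ?m * card (coloured_cycles \<phi>)"
    unfolding coloured_cycles_def by blast
  let ?X = "heavies \<phi> \<union> heavies (reflect \<phi>)"
  let ?Q = "light_cycles \<phi> \<inter> {xs. set xs \<inter> heavies (reflect \<phi>) = {}}"
  let ?T = "\<lambda>v. {xs \<in> long_cycles. v \<in> set xs}"
  have "card (\<Union>v\<in>?X. ?T v) \<le> (\<Sum>v\<in>?X. card (?T v))"
    by (intro card_UN_le) (simp add: finite_heavies)
  also have "\<dots> \<le> (\<Sum>v\<in>?X. ?a * n)" by (intro sum_mono long_cycles_through_le)
  also have "\<dots> = card ?X * (?a * n)" by simp
  finally have through: "card (\<Union>v\<in>?X. ?T v) \<le> card ?X * (?a * n)" .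
  have "coloured_cycles \<phi> \<subseteq> (\<Union>v\<in>?X. ?T v) \<union> ?Q"
    by (auto simp: light_cycles_def coloured_cycles_def)
  then have "card (coloured_cycles \<phi>) \<le> card ((\<Union>v\<in>?X. ?T v) \<union> ?Q)"
    using finite_long_cycles finite_heavies finite_coloured_cycles
    by (intro card_mono) (auto simp: light_cycles_def)
  also have "\<dots> \<le> card (\<Union>v\<in>?X. ?T v) + card ?Q" by (rule card_Un_le)
  also have "\<dots> \<le> card ?X * (?a * n) + card ?Q" using through by (rule add_right_mono)
  finally have "real (card (coloured_cycles \<phi>)) \<le> real (card ?X * (?a * n) + card ?Q)"
    by (rule of_nat_mono)
  also have "\<dots> = real (card ?X) * (real ?a * real n) + real (card ?Q)"
    by (simp only: of_nat_add of_nat_mult)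
  also have "\<dots> \<le> (2 * real k * real n powr (1 - ?e)) * (real ?a * real n) + real ?b * real n powr (2 - ?e)"
  proof (intro add_mono mult_right_mono card_light_cycles_le)
    have "real (card ?X) \<le> real (card (heavies \<phi>)) + real (card (heavies (reflect \<phi>)))"
      by (metis card_Un_le of_nat_add of_nat_le_iff)
    then show "real (card ?X) \<le> 2 * real k * real n powr (1 - ?e)"
      using card_heavies_le[of \<phi>] card_heavies_le[of "reflect \<phi>"] by simp
  qed simp
  also have "\<dots> = real (2 * k * ?a) * (real n powr (1 - ?e) * real n) + real ?b * real n powr (2 - ?e)"
    by (simp only: of_nat_mult of_nat_numeral mult_ac)
  also have "real n powr (1 - ?e) * real n = real n powr (2 - ?e)"
    using n_pos powr_add[of "real n" "1 - ?e" 1] by simp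
  also have "real (2 * k * ?a) * real n powr (2 - ?e) + real ?b * real n powr (2 - ?e)
      = real (2 * k * ?a + ?b) * real n powr (2 - ?e)"
    by (simp only: of_nat_add distrib_right)
  finally have "real (?m ^ ?m) * real (card (coloured_cycles \<phi>))
      \<le> real (?m ^ ?m) * (real (2 * k * ?a + ?b) * real n powr (2 - ?e))"
    by (rule mult_left_mono) simp
  moreover have "real (card long_cycles) \<le> real (?m ^ ?m) * real (card (coloured_cycles \<phi>))"
    using \<phi> by (metis of_nat_le_iff of_nat_mult)
  ultimately show ?thesis by (simp only: of_nat_mult mult.assoc)
qed

end

section \<open>Copies of cycle graphs\<close>

lemma copies_cycle_graph_nonempty:
  assumes G: "simple_graph G" and xs: "cycle_list (\<lambda>x y. {x, y} \<in> edges G) xs"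
  shows "copies (cycle_graph (length xs)) G \<noteq> {}"
proof -
  let ?m = "length xs"
  define E where "E = (\<lambda>j. {xs ! j, xs ! (Suc j mod ?m)}) ` {..<?m}"
  define f where "f = inv_into {..<?m} ((!) xs)"
  have m: "3 \<le> ?m" "distinct xs" using xs by (auto simp: cycle_list_def)
  have inj: "inj_on ((!) xs) {..<?m}" using m by (auto simp: inj_on_def nth_eq_iff_index_eq)
  have f: "f (xs ! j) = j" if "j < ?m" for j using inj that by (simp add: f_def)
  have E: "E \<subseteq> edges G" using cycle_list_nth_mod[OF xs] by (auto simp: E_def)
  have "0 < ?m" using m by linarith
  then have E_V: "e \<subseteq> set xs" if "e \<in> E" for e using that by (auto simp: E_def)
  have "set xs \<subseteq> verts G"
  proof
    fix x assume "x \<in> set xs"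
    then obtain j where "j < ?m" "x = xs ! j" by (auto simp: in_set_conv_nth)
    then have "\<exists>e \<in> edges G. x \<in> e" using E by (auto simp: E_def)
    then show "x \<in> verts G" using G by (auto simp: simple_graph_def)
  qed
  then have "subgraph (set xs, E) G"
    using G E E_V by (auto simp: subgraph_def simple_graph_def)
  moreover have "graph_iso (set xs, E) (cycle_graph ?m)"
    unfolding graph_iso_def
  proof (intro exI[of _ f] conjI)
    show "bij_betw f (verts (set xs, E)) (verts (cycle_graph ?m))"
      using bij_betw_inv_into[OF bij_betw_nth[OF m(2) refl refl]]
      by (simp add: f_def cycle_graph_def)
    have "(\<lambda>e. f ` e) ` E = (\<lambda>j. {j, Suc j mod ?m}) ` {..<?m}"
      unfolding E_def image_image using f \<open>0 < ?m\<close> by (intro image_cong) auto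
    then show "edges (cycle_graph ?m) = (\<lambda>e. f ` e) ` edges (set xs, E)"
      by (auto simp: cycle_graph_def)
  qed
  ultimately show ?thesis by (auto simp: copies_def)
qed

lemma num_copies_cycle_graph_le:
  assumes m: "3 \<le> m" and fin: "finite {xs. cycle_list (\<lambda>x y. {x, y} \<in> edges G) xs \<and> length xs = m}"
  shows "num_copies (cycle_graph m) G
    \<le> card {xs. cycle_list (\<lambda>x y. {x, y} \<in> edges G) xs \<and> length xs = m}"
    (is "_ \<le> card ?L")
proof -
  let ?g = "\<lambda>xs. (set xs, (\<lambda>j. {xs ! j, xs ! (Suc j mod m)}) ` {..<m})"
  have cyc: "verts (cycle_graph m) = {..<m}"
    "edges (cycle_graph m) = (\<lambda>j. {j, Suc j mod m}) ` {..<m}"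
    by (auto simp: cycle_graph_def)
  have "copies (cycle_graph m) G \<subseteq> ?g ` ?L"
  proof
    fix S assume "S \<in> copies (cycle_graph m) G"
    then obtain f where S: "subgraph S G" and f: "bij_betw f (verts S) {..<m}"
      and edges: "(\<lambda>j. {j, Suc j mod m}) ` {..<m} = (\<lambda>e. f ` e) ` edges S"
      unfolding copies_def graph_iso_def cyc by blast
    define h where "h = inv_into (verts S) f"
    define xs where "xs = map h [0..<m]"
    have h: "bij_betw h {..<m} (verts S)" unfolding h_def using f by (rule bij_betw_inv_into)
    have hf: "h ` f ` e = e" if "e \<in> edges S" for e
    proof -
      have "e \<subseteq> verts S" using S that by (auto simp: subgraph_def simple_graph_def)
      then show ?thesis
        unfolding h_def using f by (simp add: bij_betw_def inv_into_image_cancel)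
    qed
    have len: "length xs = m" and set: "set xs = verts S"
      using h by (auto simp: xs_def bij_betw_def atLeast0LessThan)
    have nth: "xs ! j = h j" if "j < m" for j using that by (simp add: xs_def)
    have "edges S = (\<lambda>e. h ` f ` e) ` edges S" using hf by auto
    also have "\<dots> = (\<lambda>j. h ` {j, Suc j mod m}) ` {..<m}"
      using arg_cong[OF edges, of "\<lambda>A. (\<lambda>e. h ` e) ` A"] by (simp only: image_image)
    also have "\<dots> = (\<lambda>j. {xs ! j, xs ! (Suc j mod m)}) ` {..<m}"
      using nth m by (intro image_cong) auto
    finally have E: "edges S = (\<lambda>j. {xs ! j, xs ! (Suc j mod m)}) ` {..<m}" .
    have "cycle_list (\<lambda>x y. {x, y} \<in> edges G) xs"
    proof (rule cycle_listI_nth_mod)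
      show "3 \<le> length xs" using len m by simp
      show "distinct xs" using h by (simp add: xs_def distinct_map bij_betw_def atLeast0LessThan)
      show "{xs ! i, xs ! (Suc i mod length xs)} \<in> edges G" if "i < length xs" for i
        using S E that len by (auto simp: subgraph_def)
    qed
    then show "S \<in> ?g ` ?L"
      using E set len by (intro image_eqI[of _ _ xs]) (auto simp: prod_eq_iff)
  qed
  then have "card (copies (cycle_graph m) G) \<le> card (?g ` ?L)"
    using fin by (intro card_mono) auto
  also have "\<dots> \<le> card ?L" using fin by (rule card_image_le)
  finally show ?thesis by (simp add: num_copies_def)
qed

theorem mainTheorem2:
  fixes k l :: nat
  assumes "1 \<le> k" and "k < l"
  shows "\<exists>\<epsilon>::real. \<epsilon> > 0 \<and> (\<exists>C::real. \<forall>n::nat. n \<ge> 1 \<longrightarrow>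
           real (gen_turan n (cycle_graph (2 * k + 1))
                   (cycles_upto (2 * k) \<union> {cycle_graph (2 * l + 1)}))
             \<le> C * real n powr (2 - \<epsilon>))"
proof -
  let ?F = "cycles_upto (2 * k) \<union> {cycle_graph (2 * l + 1)}"
  define s where "s = l - k"
  let ?C = "real ((2 * k + 1) ^ (2 * k + 1) *
    (2 * k * ((2 * k + 1) ^ (2 * k + 2) * (2 * s + 1)) + (2 * s + 1) * (2 * ((2 * s + 1) * 2 ^ k))))"
  have "real (gen_turan n (cycle_graph (2 * k + 1)) ?F) \<le> ?C * real n powr (2 - 1 / 3 ^ k)"
    if n: "n \<ge> 1" for n
  proof -
    have "\<forall>H \<in> ?F. edges H \<noteq> {}" by (auto simp: cycles_upto_def cycle_graph_def intro: exI[of _ 0])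
    then have "gen_turan n (cycle_graph (2 * k + 1)) ?F
        \<in> gen_turan_values n (cycle_graph (2 * k + 1)) ?F"
      unfolding gen_turan_def by (intro Max_in finite_gen_turan_values gen_turan_values_nonempty)
    then obtain G :: "nat graph" where G: "simple_graph G" "card (verts G) = n" "free_of ?F G"
      and max: "gen_turan n (cycle_graph (2 * k + 1)) ?F = num_copies (cycle_graph (2 * k + 1)) G"
      by (auto simp: gen_turan_values_def)
    let ?adj = "\<lambda>x y. {x, y} \<in> edges G"
    have free: "cycle_graph (length xs) \<notin> ?F" if "cycle_list ?adj xs" for xs
      using copies_cycle_graph_nonempty[OF G(1) that] G(3) by (auto simp: free_of_def)
    interpret odd_cycle_host "verts G" ?adj k s
    proof
      show "finite (verts G)" using G(1) by (simp add: simple_graph_def)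
      show "verts G \<noteq> {}" using G(2) n by auto
      show "?adj y x" if "?adj x y" for x y using that by (simp add: insert_commute)
      show "x \<in> verts G \<and> y \<in> verts G" if "?adj x y" for x y
        using that G(1) by (auto simp: simple_graph_def)
      show "1 \<le> k" by fact
      show "2 * k < length xs" if "cycle_list ?adj xs" for xs
      proof -
        have "3 \<le> length xs" using that by (simp add: cycle_list_def)
        then show ?thesis using free[OF that] by (force simp: cycles_upto_def)
      qed
      show "length xs \<noteq> 2 * k + 2 * s + 1" if "cycle_list ?adj xs" for xs
      proof
        assume "length xs = 2 * k + 2 * s + 1"
        then have "length xs = 2 * l + 1" using assms(2) by (simp add: s_def)
        then show False using free[OF that] by simp
      qed
    qed
    have "real (num_copies (cycle_graph (2 * k + 1)) G) \<le> real (card long_cycles)"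
      using num_copies_cycle_graph_le[of "2 * k + 1" G] finite_long_cycles assms(1)
      by (simp add: long_cycles_def)
    also note card_long_cycles_le
    finally show ?thesis unfolding G(2) max .
  qed
  then show ?thesis by (intro exI[of _ "1 / 3 ^ k"] conjI exI[of _ ?C]) auto
qed

end
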